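(* Let $F_1,F_2$ be indexed forests, and expand $\mathfrak{P}_{F_1}\mathfrak{P}_{F_2}=\sum_{G}b^{G}_{F_1,F_2}\mathfrak{P}_G$ in the basis $\{\mathfrak{P}_G:G\in\mathsf{IndFor}_+\}$ of $\mathbb{Q}[x_1,x_2,\dots]$. Then all coefficients $b^G_{F_1,F_2}$ lie in $\mathbb{Z}_{\ge0}$.
   Context: Indexed forests: for a finite set $S\subset\mathbb{Z}$ with maximal consecutive blocks $I_1<\cdots<I_k$, an indexed forest $F$ with support $S$ is a tuple of plane binary trees $T_j$ with $|I_j|$ nodes, canonically labeled by $I_j$ in inorder (missing children are leaves). $\mathsf{IndFor}_+$ denotes those with $S\subset\mathbb{Z}_{\ge1}$. $\rho_F(v)$ is the canonical label of the node reached from $v$ by following left children as long as possible. The forest polynomial is $\mathfrak{P}_F=\sum_\kappa\prod_vx_{\kappa(v)}$ over $\kappa:\operatorname{IN}(F)\to\mathbb{Z}_{\ge1}$ with $\kappa(v)\le\rho_F(v)$, $\kappa(\text{left child of }u)\ge\kappa(u)$, and $\kappa(\text{right child of }u)>\kappa(u)$; the empty forest gives $1$. (It is $0$ if $F\notin\mathsf{IndFor}_+$.) *)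

theory Defs
  imports Complex_Main "HOL-Library.Tree" "HOL-Library.FuncSet" "HOL-Library.Poly_Mapping"
begin

text \<open>
  Polynomials over \<open>\<rat>\<close> are finitely supported functions from exponent vectors to
  coefficients; the product of \<^typ>\<open>'a \<Rightarrow>\<^sub>0 'b\<close> is convolution. The variables are
  \<open>x\<^sub>i\<close> with \<open>i \<ge> 1\<close>; index 0 is never used.
\<close>

type_synonym qpoly = "(nat \<Rightarrow>\<^sub>0 nat) \<Rightarrow>\<^sub>0 rat"

definition qvar :: "nat \<Rightarrow> qpoly" where
  "qvar i = Poly_Mapping.single (Poly_Mapping.single i 1) 1"

definition qconst :: "rat \<Rightarrow> qpoly" where
  "qconst c = Poly_Mapping.single 0 c"

definition consecutive_blocks :: "int set \<Rightarrow> int set set" where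
  "consecutive_blocks S = {I. \<exists>a b. a \<le> b \<and> I = {a..b} \<and> I \<subseteq> S \<and> a - 1 \<notin> S \<and> b + 1 \<notin> S}"

text \<open>
  A forest is the tuple \<open>(T\<^sub>1, \<dots>, T\<^sub>k)\<close> of its trees, each node carrying its canonical label.
  The canonical labels of an indexed forest are pairwise distinct, so that its internal nodes
  are identified with the elements of its support.
\<close>

type_synonym forest = "int tree list"

definition support :: "forest \<Rightarrow> int set" where
  "support F = (\<Union>T\<in>set F. set_tree T)"

definition indexed_forest :: "forest \<Rightarrow> bool" where
  "indexed_forest F \<longleftrightarrow>
     sorted_wrt (\<lambda>T T'. \<forall>i\<in>set_tree T. \<forall>j\<in>set_tree T'. i < j) F \<and>
     (\<forall>T\<in>set F. set_tree T \<in> consecutive_blocks (support F) \<and>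
        inorder T = sorted_list_of_set (set_tree T))"

definition IndFor_plus :: "forest set" where
  "IndFor_plus = {F. indexed_forest F \<and> support F \<subseteq> {1..}}"

fun leftmost_label :: "'a tree \<Rightarrow> 'a" where
  "leftmost_label \<langle>\<langle>\<rangle>, a, r\<rangle> = a"
| "leftmost_label \<langle>l, a, r\<rangle> = leftmost_label l"

text \<open>
  The node \<open>v\<close> is given by the subtree \<open>\<langle>l, v, r\<rangle>\<close> hanging from it, and
  \<open>\<rho>\<^sub>F(v)\<close> is \<^term>\<open>leftmost_label \<langle>l, v, r\<rangle>\<close>.
\<close>

definition colorings :: "forest \<Rightarrow> (int \<Rightarrow> nat) set" where
  "colorings F = {\<kappa> \<in> support F \<rightarrow>\<^sub>E {1..}. \<forall>T\<in>set F.
     (\<forall>l v r. \<langle>l, v, r\<rangle> \<in> subtrees T \<longrightarrow> int (\<kappa> v) \<le> leftmost_label \<langle>l, v, r\<rangle>) \<and>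
     (\<forall>l w l' u r. \<langle>\<langle>l, w, l'\<rangle>, u, r\<rangle> \<in> subtrees T \<longrightarrow> \<kappa> w \<ge> \<kappa> u) \<and>
     (\<forall>l u r w r'. \<langle>l, u, \<langle>r, w, r'\<rangle>\<rangle> \<in> subtrees T \<longrightarrow> \<kappa> w > \<kappa> u)}"

definition forest_poly :: "forest \<Rightarrow> qpoly" where
  "forest_poly F = (\<Sum>\<kappa>\<in>colorings F. \<Prod>v\<in>support F. qvar (\<kappa> v))"

definition forest_expansion :: "qpoly \<Rightarrow> (forest \<Rightarrow>\<^sub>0 rat) \<Rightarrow> bool" where
  "forest_expansion p b \<longleftrightarrow> Poly_Mapping.keys b \<subseteq> IndFor_plus \<and>
     p = (\<Sum>G\<in>Poly_Mapping.keys b. qconst (Poly_Mapping.lookup b G) * forest_poly G)"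

lemma finite_support: "finite (support F)"
  by (simp add: support_def)

lemma leftmost_label_in: "t \<noteq> \<langle>\<rangle> \<Longrightarrow> leftmost_label t \<in> set_tree t"
  by (induction t rule: leftmost_label.induct) auto

lemma finite_colorings: "finite (colorings F)"
proof -
  define M where "M = nat (Max (support F))"
  have "colorings F \<subseteq> support F \<rightarrow>\<^sub>E {1..M}"
  proof (rule subsetI)
    fix \<kappa> assume k: "\<kappa> \<in> colorings F"
    have "\<kappa> v \<le> M" if v: "v \<in> support F" for v
    proof -
      from v obtain T where T: "T \<in> set F" "v \<in> set_tree T"
        by (auto simp: support_def)
      from set_treeE[OF T(2)] obtain l r where s: "\<langle>l, v, r\<rangle> \<in> subtrees T" by blast
      have "set_tree t \<subseteq> set_tree T'" if "t \<in> subtrees T'" for t and T' :: "int tree"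
        using that by (induction T') auto
      from this[OF s] leftmost_label_in[of "\<langle>l, v, r\<rangle>"] T(1)
      have "leftmost_label \<langle>l, v, r\<rangle> \<in> support F" by (auto simp: support_def)
      hence "leftmost_label \<langle>l, v, r\<rangle> \<le> Max (support F)"
        by (simp add: finite_support)
      moreover have "int (\<kappa> v) \<le> leftmost_label \<langle>l, v, r\<rangle>"
        using k s T(1) by (auto simp: colorings_def)
      ultimately show ?thesis by (simp add: M_def)
    qed
    thus "\<kappa> \<in> support F \<rightarrow>\<^sub>E {1..M}"
      using k by (auto simp: colorings_def PiE_iff)
  qed
  thus ?thesis
    by (rule finite_subset) (simp add: finite_PiE finite_support)
qed

lemma forest_poly_Nil: "forest_poly [] = 1"
  by (simp add: forest_poly_def colorings_def support_def)

lemma forest_poly_eq_0: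
  assumes "indexed_forest F" "F \<notin> IndFor_plus"
  shows "forest_poly F = 0"
proof -
  from assms obtain v where v: "v \<in> support F" "v < 1"
    by (fastforce simp: IndFor_plus_def)
  then obtain T where T: "T \<in> set F" "v \<in> set_tree T"
    by (auto simp: support_def)
  from set_treeE[OF T(2)] obtain l r where s: "\<langle>l, v, r\<rangle> \<in> subtrees T" by blast
  have "inorder T = sorted_list_of_set (set_tree T)"
    using assms(1) T(1) by (simp add: indexed_forest_def)
  hence "sorted (inorder T)" by simp
  hence "sorted (inorder \<langle>l, v, r\<rangle>)"
    using s by (induction T) (auto simp: sorted_append)
  hence "\<forall>i\<in>set_tree l. i \<le> v" by (auto simp: sorted_append)
  hence le: "leftmost_label \<langle>l, v, r\<rangle> \<le> v"
    using leftmost_label_in[of l] by (cases l) auto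
  have "colorings F = {}"
  proof (rule ccontr)
    assume "colorings F \<noteq> {}"
    then obtain \<kappa> where k: "\<kappa> \<in> colorings F" by blast
    have "1 \<le> \<kappa> v" using k v(1) by (auto simp: colorings_def PiE_iff)
    moreover have "int (\<kappa> v) \<le> leftmost_label \<langle>l, v, r\<rangle>"
      using k s T(1) by (auto simp: colorings_def)
    ultimately show False using le v(2) by linarith
  qed
  thus ?thesis by (simp add: forest_poly_def)
qed

end

theory Submission
  imports Defs "HOL-Library.Multiset"
begin

text \<open>
  Let \<open>R\<^sub>i f = f(x\<^sub>1, \<dots>, x\<^sub>i\<^sub>-\<^sub>1, 0, x\<^sub>i, \<dots>)\<close> and \<open>T\<^sub>i f = (R\<^sub>i\<^sub>+\<^sub>1 f - R\<^sub>i f) / x\<^sub>i\<close>.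
  If the leaves \<open>i\<close> and \<open>i + 1\<close> of \<open>F\<close> are siblings, \<open>T\<^sub>i\<close> maps \<open>P\<^sub>F\<close> to the polynomial of the forest
  obtained by deleting their parent; otherwise it kills \<open>P\<^sub>F\<close>. Hence each coefficient of a forest
  expansion of \<open>f\<close> is the constant term of \<open>T\<^sub>w f\<close> for a suitable word \<open>w\<close>. Call \<open>f\<close> positive if
  these constant terms are natural numbers for all words. The relations
  \<open>T\<^sub>i R\<^sub>j = R\<^sub>j T\<^sub>i\<^sub>+\<^sub>1\<close> for \<open>j \<le> i\<close>, \<open>T\<^sub>i R\<^sub>j\<^sub>+\<^sub>1 = R\<^sub>j T\<^sub>i\<close> for \<open>i < j\<close>, and
  \<open>T\<^sub>i R\<^sub>i\<^sub>+\<^sub>1 = R\<^sub>i\<^sub>+\<^sub>1 T\<^sub>i + R\<^sub>i T\<^sub>i\<^sub>+\<^sub>1\<close> show that \<open>R\<^sub>j\<close> preserves positivity, and then the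
  Leibniz rule \<open>T\<^sub>i (f g) = T\<^sub>i f \<cdot> R\<^sub>i\<^sub>+\<^sub>1 g + R\<^sub>i f \<cdot> T\<^sub>i g\<close> shows that products of positive
  polynomials are positive.
\<close>

section \<open>Quasisymmetric divided differences\<close>

type_synonym monom = "nat \<Rightarrow>\<^sub>0 nat"

section \<open>Exponent vectors with an inserted zero and the substitutions they induce\<close>

lemma poly_mapping_single_induct [case_names single add]:
  assumes "\<And>a c. P (Poly_Mapping.single a c)"
    and "\<And>f g. P f \<Longrightarrow> P g \<Longrightarrow> P (f + g)"
  shows "P (f :: 'a \<Rightarrow>\<^sub>0 'b::monoid_add)"
proof (induction f rule: update_induct)
  case const
  show ?case using assms(1)[of _ 0] by simp
next
  case (update f a b)
  have "Poly_Mapping.update a b f = Poly_Mapping.single a b + f"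
    using update(1)
    by (intro poly_mapping_eqI)
      (auto simp: lookup_add lookup_single lookup_update when_def in_keys_iff)
  thus ?case using assms update by metis
qed

text \<open>Setting x_i = 0 and moving the later variables down by one keeps only monomials free of
  x_i, so the new coefficient of \<open>m\<close> is the old one at
  \<open>insert_zero i m\<close>.\<close>

lift_definition insert_zero :: "nat \<Rightarrow> monom \<Rightarrow> monom" is
  "\<lambda>i m j. if j < i then m j else if j = i then 0 else m (j - 1)"
proof -
  fix i :: nat and m :: "nat \<Rightarrow> nat"
  assume "finite {j. m j \<noteq> 0}"
  moreover have "{j. (if j < i then m j else if j = i then 0 else m (j - 1)) \<noteq> 0}
      \<subseteq> {j. m j \<noteq> 0} \<union> Suc ` {j. m j \<noteq> 0}"
  proof
    fix j assume "j \<in> {j. (if j < i then m j else if j = i then 0 else m (j - 1)) \<noteq> 0}"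
    thus "j \<in> {j. m j \<noteq> 0} \<union> Suc ` {j. m j \<noteq> 0}"
      by (cases j) (auto split: if_splits)
  qed
  ultimately show "finite {j. (if j < i then m j else if j = i then 0 else m (j - 1)) \<noteq> 0}"
    by (meson finite_UnI finite_imageI finite_subset)
qed

lemma insert_zero_add: "insert_zero i (a + b) = insert_zero i a + insert_zero i b"
  by (rule poly_mapping_eqI) (simp add: insert_zero.rep_eq lookup_add)

lemma insert_zero_0 [simp]: "insert_zero i 0 = 0"
  by (rule poly_mapping_eqI) (simp add: insert_zero.rep_eq)

lemma inj_insert_zero: "inj (insert_zero i)"
proof (rule injI, rule poly_mapping_eqI)
  fix a b j assume eq: "insert_zero i a = insert_zero i b"
  have "Poly_Mapping.lookup (insert_zero i a) (if j < i then j else Suc j) =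
        Poly_Mapping.lookup (insert_zero i b) (if j < i then j else Suc j)"
    by (simp only: eq)
  thus "Poly_Mapping.lookup a j = Poly_Mapping.lookup b j"
    by (simp add: insert_zero.rep_eq split: if_splits)
qed

lemma insert_zeroE:
  assumes "Poly_Mapping.lookup m i = 0"
  obtains m' where "m = insert_zero i m'"
proof -
  define s where "s = (\<lambda>j. if j < i then j else Suc j)"
  have "inj s" by (auto simp: inj_def s_def split: if_splits)
  hence "m = insert_zero i (Poly_Mapping.map_key s m)"
    using assms by (intro poly_mapping_eqI) (auto simp: insert_zero.rep_eq map_key.rep_eq s_def)
  thus thesis by (rule that)
qed

text \<open>The cosimplicial identity for coface maps; it yields the commutation rule
  \<open>bs_bs\<close>.\<close>

lemma insert_zero_commute:
  "j \<le> i \<Longrightarrow> insert_zero j (insert_zero i m) = insert_zero (Suc i) (insert_zero j m)"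
  by (rule poly_mapping_eqI) (auto simp: insert_zero.rep_eq)

text \<open>\<open>bs i\<close> is the operator \<open>R\<^sub>i\<close> (a Bergeron--Sottile map), given by its action on coefficients.\<close>

definition bs :: "nat \<Rightarrow> qpoly \<Rightarrow> qpoly" where
  "bs i = Poly_Mapping.map_key (insert_zero i)"

lemma lookup_bs: "Poly_Mapping.lookup (bs i f) m = Poly_Mapping.lookup f (insert_zero i m)"
  by (simp add: bs_def map_key.rep_eq inj_insert_zero)

lemma bs_add: "bs i (f + g) = bs i f + bs i g"
  and bs_diff: "bs i (f - g) = bs i f - bs i g"
  and bs_0 [simp]: "bs i 0 = 0"
  by (rule poly_mapping_eqI, simp add: lookup_bs lookup_add lookup_minus)+

lemma bs_sum: "bs i (\<Sum>x\<in>A. f x) = (\<Sum>x\<in>A. bs i (f x))"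
  by (induction A rule: infinite_finite_induct) (simp_all add: bs_add)

lemma bs_single_insert_zero:
  "bs i (Poly_Mapping.single (insert_zero i m) c) = Poly_Mapping.single m c"
  by (rule poly_mapping_eqI) (simp add: lookup_bs lookup_single when_def inj_eq[OF inj_insert_zero])

lemma bs_single_eq_0:
  "Poly_Mapping.lookup m i \<noteq> 0 \<Longrightarrow> bs i (Poly_Mapping.single m c) = 0"
  by (rule poly_mapping_eqI) (auto simp: lookup_bs lookup_single when_def insert_zero.rep_eq)

text \<open>Either both monomials avoid x_i and \<open>insert_zero\<close> is additive, or one
  contains x_i, hence so does the product, and both sides vanish.\<close>

lemma bs_single_mult:
  "bs i (Poly_Mapping.single a c * Poly_Mapping.single b d) =
   bs i (Poly_Mapping.single a c) * bs i (Poly_Mapping.single b d)"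
proof (cases "Poly_Mapping.lookup a i = 0 \<and> Poly_Mapping.lookup b i = 0")
  case True
  then obtain a' b' where "a = insert_zero i a'" "b = insert_zero i b'"
    by (meson insert_zeroE)
  thus ?thesis
    by (simp add: mult_single bs_single_insert_zero flip: insert_zero_add)
next
  case False
  hence "Poly_Mapping.lookup (a + b) i \<noteq> 0" by (simp add: lookup_add)
  thus ?thesis using False by (auto simp: mult_single bs_single_eq_0)
qed

lemma bs_mult: "bs i (f * g) = bs i f * bs i g"
proof (induction f rule: poly_mapping_single_induct)
  case (single a c)
  show ?case
    by (induction g rule: poly_mapping_single_induct) (simp_all add: bs_single_mult distrib_left bs_add)
qed (simp add: distrib_right bs_add)

lemma bs_const [simp]: "bs i (qconst c) = qconst c"
  unfolding qconst_def by (metis bs_single_insert_zero insert_zero_0)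

lemma bs_1 [simp]: "bs i 1 = 1"
  by (metis bs_const qconst_def single_one)

lemma bs_var_less: "j < i \<Longrightarrow> bs i (qvar j) = qvar j"
  and bs_var_eq: "bs i (qvar i) = 0"
  and bs_var_greater: "i \<le> j \<Longrightarrow> bs i (qvar (Suc j)) = qvar j"
proof -
  assume "j < i"
  hence "insert_zero i (Poly_Mapping.single j 1) = Poly_Mapping.single j 1"
    by (intro poly_mapping_eqI) (auto simp: insert_zero.rep_eq lookup_single when_def)
  thus "bs i (qvar j) = qvar j" unfolding qvar_def by (metis bs_single_insert_zero)
next
  show "bs i (qvar i) = 0" unfolding qvar_def by (rule bs_single_eq_0) simp
next
  assume "i \<le> j"
  hence "insert_zero i (Poly_Mapping.single j 1) = Poly_Mapping.single (Suc j) 1"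
    by (intro poly_mapping_eqI) (auto simp: insert_zero.rep_eq lookup_single when_def)
  thus "bs i (qvar (Suc j)) = qvar j" unfolding qvar_def by (metis bs_single_insert_zero)
qed

lemma bs_bs: "j \<le> i \<Longrightarrow> bs i (bs j f) = bs j (bs (Suc i) f)"
  by (rule poly_mapping_eqI) (simp add: lookup_bs insert_zero_commute)

section \<open>Exact division by a variable\<close>

lemma lookup_qvar_mult:
  "Poly_Mapping.lookup (qvar i * f) m =
    (if Poly_Mapping.lookup m i = 0 then 0
     else Poly_Mapping.lookup f (m - Poly_Mapping.single i 1))"
proof (induction f rule: poly_mapping_single_induct)
  case (single b c)
  have "Poly_Mapping.single i 1 + b = m \<longleftrightarrow>
      Poly_Mapping.lookup m i \<noteq> 0 \<and> b = m - Poly_Mapping.single i 1"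
    by (auto simp: poly_mapping_eq_iff fun_eq_iff lookup_add lookup_minus lookup_single when_def
        split: if_splits)
  thus ?case by (auto simp: qvar_def mult_single lookup_single when_def)
qed (simp add: distrib_left lookup_add)

lemma lookup_qvar_mult_add:
  "Poly_Mapping.lookup (qvar i * f) (m + Poly_Mapping.single i 1) = Poly_Mapping.lookup f m"
  by (simp add: lookup_qvar_mult lookup_add)

text \<open>\<open>qdd i\<close> is the operator \<open>T\<^sub>i\<close>; the division by \<open>x\<^sub>i\<close> is a shift of exponents.\<close>

definition qdd :: "nat \<Rightarrow> qpoly \<Rightarrow> qpoly" where
  "qdd i f = Poly_Mapping.map_key (\<lambda>m. m + Poly_Mapping.single i 1) (bs (Suc i) f - bs i f)"

lemma lookup_qdd:
  "Poly_Mapping.lookup (qdd i f) m =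
    Poly_Mapping.lookup f (insert_zero (Suc i) (m + Poly_Mapping.single i 1)) -
    Poly_Mapping.lookup f (insert_zero i (m + Poly_Mapping.single i 1))"
  by (simp add: qdd_def map_key.rep_eq lookup_minus lookup_bs)

text \<open>The division is exact: for a monomial without x_i, inserting the zero at
  \<open>i\<close> or at \<open>Suc i\<close> gives the same exponent vector, so the two
  coefficients cancel.\<close>

lemma qvar_mult_qdd: "qvar i * qdd i f = bs (Suc i) f - bs i f"
proof (rule poly_mapping_eqI)
  fix m
  show "Poly_Mapping.lookup (qvar i * qdd i f) m = Poly_Mapping.lookup (bs (Suc i) f - bs i f) m"
  proof (cases "Poly_Mapping.lookup m i = 0")
    case True
    hence "insert_zero (Suc i) m = insert_zero i m"
      by (intro poly_mapping_eqI) (auto simp: insert_zero.rep_eq less_Suc_eq)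
    thus ?thesis using True by (simp add: lookup_qvar_mult lookup_minus lookup_bs)
  next
    case False
    hence "m = (m - Poly_Mapping.single i 1) + Poly_Mapping.single i 1"
      by (intro poly_mapping_eqI) (auto simp: lookup_add lookup_minus lookup_single when_def)
    thus ?thesis
      by (metis lookup_qvar_mult_add lookup_qdd lookup_minus lookup_bs)
  qed
qed

lemma qvar_mult_cancel: "qvar i * f = qvar i * g \<Longrightarrow> f = g"
  by (metis lookup_qvar_mult_add poly_mapping_eqI)

lemma bs_Suc: "bs (Suc i) f = bs i f + qvar i * qdd i f"
  by (simp add: qvar_mult_qdd)

text \<open>Multiplication by x_i is injective, so identities for \<open>qdd i\<close> may be
  checked after clearing the denominator.\<close>

lemma qdd_unique: "bs (Suc i) f = bs i f + qvar i * g \<Longrightarrow> qdd i f = g"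
  by (rule qvar_mult_cancel[of i]) (simp add: qvar_mult_qdd)

lemma qdd_add: "qdd i (f + g) = qdd i f + qdd i g"
  by (rule qdd_unique) (simp add: bs_add bs_Suc distrib_left)

lemma qdd_diff: "qdd i (f - g) = qdd i f - qdd i g"
  by (rule qdd_unique) (simp add: bs_diff bs_Suc right_diff_distrib)

lemma qdd_0 [simp]: "qdd i 0 = 0"
  by (rule qdd_unique) simp

lemma qdd_mult: "qdd i (f * g) = qdd i f * bs (Suc i) g + bs i f * qdd i g"
  by (rule qdd_unique) (simp add: bs_mult bs_Suc algebra_simps)

lemma qdd_const_mult: "qdd i (qconst c * f) = qconst c * qdd i f"
  by (rule qdd_unique) (simp add: bs_mult bs_Suc algebra_simps)

text \<open>Substitutions slide past \<open>bs j\<close> with their index raised by one, and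
  \<open>bs j\<close> sends x_(i+1) to x_i, the denominator on the left.\<close>

lemma qdd_bs_le:
  assumes "j \<le> i"
  shows "qdd i (bs j f) = bs j (qdd (Suc i) f)"
proof (rule qdd_unique)
  have "bs (Suc i) (bs j f) = bs j (bs (Suc i) f + qvar (Suc i) * qdd (Suc i) f)"
    using assms by (simp add: bs_bs flip: bs_Suc)
  thus "bs (Suc i) (bs j f) = bs i (bs j f) + qvar i * bs j (qdd (Suc i) f)"
    using assms by (simp add: bs_add bs_mult bs_var_greater bs_bs)
qed

lemma qdd_bs_Suc_less:
  assumes "i < j"
  shows "qdd i (bs (Suc j) f) = bs j (qdd i f)"
proof (rule qdd_unique)
  have "bs (Suc i) (bs (Suc j) f) = bs j (bs i f + qvar i * qdd i f)"
    using assms by (simp add: bs_bs flip: bs_Suc)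
  thus "bs (Suc i) (bs (Suc j) f) = bs i (bs (Suc j) f) + qvar i * bs j (qdd i f)"
    using assms by (simp add: bs_add bs_mult bs_var_less bs_bs)
qed

text \<open>The two quotients on the right telescope, since \<open>bs (Suc i) (bs i f)\<close> and
  \<open>bs i (bs (Suc (Suc i)) f)\<close> coincide.\<close>

lemma qdd_bs_Suc: "qdd i (bs (Suc i) f) = bs (Suc i) (qdd i f) + bs i (qdd (Suc i) f)"
proof (rule qdd_unique)
  have "qvar i * bs (Suc i) (qdd i f) = bs (Suc i) (bs (Suc i) f) - bs (Suc i) (bs i f)"
    by (metis bs_diff bs_mult bs_var_less lessI qvar_mult_qdd)
  moreover have "qvar i * bs i (qdd (Suc i) f) = bs i (bs (Suc (Suc i)) f) - bs i (bs (Suc i) f)"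
    by (metis bs_diff bs_mult bs_var_greater order_refl qvar_mult_qdd)
  moreover have "bs (Suc i) (bs i f) = bs i (bs (Suc (Suc i)) f)"
    by (simp add: bs_bs)
  ultimately show "bs (Suc i) (bs (Suc i) f) =
      bs i (bs (Suc i) f) + qvar i * (bs (Suc i) (qdd i f) + bs i (qdd (Suc i) f))"
    by (simp add: distrib_left)
qed

section \<open>Constant terms and positivity along words\<close>

definition ev0 :: "qpoly \<Rightarrow> rat" where
  "ev0 f = Poly_Mapping.lookup f 0"

lemma ev0_add: "ev0 (f + g) = ev0 f + ev0 g"
  and ev0_diff: "ev0 (f - g) = ev0 f - ev0 g"
  and ev0_0 [simp]: "ev0 0 = 0"
  and ev0_1 [simp]: "ev0 1 = 1"
  and ev0_const [simp]: "ev0 (qconst c) = c"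
  and ev0_bs [simp]: "ev0 (bs i f) = ev0 f"
  by (simp_all add: ev0_def qconst_def lookup_add lookup_minus lookup_bs lookup_one)

lemma ev0_mult: "ev0 (f * g) = ev0 f * ev0 g"
proof (induction f rule: poly_mapping_single_induct)
  case (single a c)
  show ?case
  proof (induction g rule: poly_mapping_single_induct)
    case (single b d)
    have "a + b = 0 \<longleftrightarrow> a = 0 \<and> b = 0"
      by (auto simp: poly_mapping_eq_iff fun_eq_iff lookup_add)
    thus ?case by (auto simp: ev0_def mult_single lookup_single when_def)
  qed (simp add: distrib_left ev0_add)
qed (simp add: distrib_right ev0_add)

lemma ev0_qvar [simp]: "ev0 (qvar i) = 0"
  by (auto simp: ev0_def qvar_def lookup_single when_def poly_mapping_eq_iff fun_eq_iff)

definition qdd_coeff :: "nat list \<Rightarrow> qpoly \<Rightarrow> rat" where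
  "qdd_coeff w f = ev0 (fold qdd w f)"

lemma qdd_coeff_Nil [simp]: "qdd_coeff [] f = ev0 f"
  and qdd_coeff_Cons [simp]: "qdd_coeff (i # w) f = qdd_coeff w (qdd i f)"
  by (simp_all add: qdd_coeff_def)

lemma qdd_coeff_add: "qdd_coeff w (f + g) = qdd_coeff w f + qdd_coeff w g"
  by (induction w arbitrary: f g) (simp_all add: ev0_add qdd_add)

lemma qdd_coeff_diff: "qdd_coeff w (f - g) = qdd_coeff w f - qdd_coeff w g"
  by (induction w arbitrary: f g) (simp_all add: ev0_diff qdd_diff)

lemma qdd_coeff_0 [simp]: "qdd_coeff w 0 = 0"
  by (induction w) simp_all

lemma qdd_coeff_const_mult: "qdd_coeff w (qconst c * f) = c * qdd_coeff w f"
  by (induction w arbitrary: f) (simp_all add: ev0_mult qdd_const_mult)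

lemma qdd_coeff_sum: "qdd_coeff w (\<Sum>x\<in>A. f x) = (\<Sum>x\<in>A. qdd_coeff w (f x))"
  by (induction A rule: infinite_finite_induct) (simp_all add: qdd_coeff_add)

definition qdd_positive :: "qpoly \<Rightarrow> bool" where
  "qdd_positive f \<longleftrightarrow> (\<forall>w. 0 \<notin> set w \<longrightarrow> qdd_coeff w f \<in> \<nat>)"

lemma qdd_positive_coeff: "qdd_positive f \<Longrightarrow> 0 \<notin> set w \<Longrightarrow> qdd_coeff w f \<in> \<nat>"
  by (simp add: qdd_positive_def)

lemma qdd_positive_qdd:
  assumes "qdd_positive f" "i > 0"
  shows "qdd_positive (qdd i f)"
  unfolding qdd_positive_def using qdd_positive_coeff[OF assms(1), of "i # _"] assms(2) by simp

text \<open>Induction on the word, for all \<open>f\<close> and \<open>j\<close> at once: moving the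
  first letter past \<open>bs j\<close> leaves one or two terms, each a \<open>bs\<close> of some
  \<open>qdd\<close> of \<open>f\<close>, hence of a positive polynomial.\<close>

lemma qdd_positive_bs:
  assumes "qdd_positive f" "j > 0"
  shows "qdd_positive (bs j f)"
proof -
  have "qdd_coeff w (bs j f) \<in> \<nat>" if "0 \<notin> set w" for w
    using that assms
  proof (induction w arbitrary: f j)
    case Nil
    thus ?case using qdd_positive_coeff[of f "[]"] by simp
  next
    case (Cons i w)
    hence i: "i > 0" and w: "0 \<notin> set w" by auto
    consider "j \<le> i" | "j = Suc i" | j' where "j = Suc j'" "i < j'"
      by (metis Suc_lessI less_imp_Suc_add linorder_not_less not_less_eq)
    thus ?case
    proof cases
      case 1
      thus ?thesis using Cons i w by (simp add: qdd_bs_le qdd_positive_qdd)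
    next
      case 2
      thus ?thesis using Cons i w
        by (auto simp: qdd_bs_Suc qdd_coeff_add qdd_positive_qdd intro!: Nats_add)
    next
      case 3
      thus ?thesis using Cons i w by (simp add: qdd_bs_Suc_less qdd_positive_qdd)
    qed
  qed
  thus ?thesis by (simp add: qdd_positive_def)
qed

text \<open>By the Leibniz rule the first letter produces a sum of two products of positive
  polynomials; for the empty word the constant term is multiplicative.\<close>

lemma qdd_positive_mult:
  assumes "qdd_positive f" "qdd_positive g"
  shows "qdd_positive (f * g)"
proof -
  have "qdd_coeff w (f * g) \<in> \<nat>" if "0 \<notin> set w" for w
    using that assms
  proof (induction w arbitrary: f g)
    case Nil
    thus ?case using qdd_positive_coeff[of _ "[]"] by (simp add: ev0_mult Nats_mult)
  next
    case (Cons i w)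
    thus ?case
      by (auto simp: qdd_mult qdd_coeff_add qdd_positive_qdd qdd_positive_bs intro!: Nats_add)
  qed
  thus ?thesis by (simp add: qdd_positive_def)
qed

section \<open>Trimming forest polynomials\<close>

text \<open>
  The sum over the colorings of a tree whose leftmost leaf is \<open>a\<close> and whose root has color at
  least \<open>k\<close>. Node labels are irrelevant: they are determined by \<open>a\<close>.
\<close>

fun tree_poly :: "nat \<Rightarrow> 'a tree \<Rightarrow> nat \<Rightarrow> qpoly" where
  "tree_poly a \<langle>\<rangle> k = 1"
| "tree_poly a \<langle>l, v, r\<rangle> k =
    (\<Sum>m = k..a. qvar m * (tree_poly a l m * tree_poly (Suc (a + size l)) r (Suc m)))"

text \<open>All colors on the left exceed \<open>i\<close>. Raising \<open>a\<close> and
  \<open>k\<close> together renames every x_j to x_(j+1), and \<open>bs i\<close> undoes the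
  renaming.\<close>

lemma bs_tree_poly_below:
  "i \<le> k \<Longrightarrow> bs i (tree_poly (Suc a) t (Suc k)) = tree_poly a t k"
proof (induction t arbitrary: a k)
  case (Node l v r)
  show ?case
    unfolding tree_poly.simps bs_sum sum.shift_bounds_cl_Suc_ivl
    by (rule sum.cong) (use Node.prems in \<open>simp_all add: bs_mult bs_var_greater Node.IH\<close>)
qed simp

text \<open>Root color \<open>i\<close> is killed, smaller root colors are handled by induction, and
  larger ones move down by one through \<open>bs_tree_poly_below\<close>.\<close>

lemma bs_tree_poly_left:
  "k \<le> i \<Longrightarrow> i \<le> Suc a \<Longrightarrow> bs i (tree_poly (Suc a) t k) = tree_poly a t k"
proof (induction t arbitrary: a k)
  case (Node l v r)
  define f where "f = (\<lambda>a m. qvar m * (tree_poly a l m * tree_poly (Suc (a + size l)) r (Suc m)))"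
  have "{k..Suc a} = {k..<i} \<union> insert i {Suc i..Suc a}" "{k..a} = {k..<i} \<union> {i..a}"
    using Node.prems by auto
  moreover have "bs i (f (Suc a) m) = f a m" if "m < i" "k \<le> m" for m
    using that Node.prems by (simp add: f_def bs_mult bs_var_less Node.IH)
  moreover have "bs i (f (Suc a) i) = 0"
    by (simp add: f_def bs_mult bs_var_eq)
  moreover have "(\<Sum>m = Suc i..Suc a. bs i (f (Suc a) m)) = (\<Sum>m = i..a. f a m)"
    unfolding sum.shift_bounds_cl_Suc_ivl
    by (rule sum.cong) (simp_all add: f_def bs_mult bs_var_greater bs_tree_poly_below)
  moreover have "({k..<i} \<inter> insert i {Suc i..Suc a}) = {}" "{k..<i} \<inter> {i..a} = {}" by auto
  ultimately have "bs i (\<Sum>m = k..Suc a. f (Suc a) m) = (\<Sum>m = k..a. f a m)"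
    by (simp add: bs_sum bs_add sum.union_disjoint del: sum.cl_ivl_Suc Un_insert_right)
  thus ?case by (simp add: f_def del: sum.cl_ivl_Suc)
qed simp

text \<open>A color is at most the label of a node of the tree, hence below
  \<open>a + size t\<close>.\<close>

lemma bs_tree_poly_right: "a + size t \<le> i \<Longrightarrow> bs i (tree_poly a t k) = tree_poly a t k"
  by (induction t arbitrary: a k) (auto simp: bs_sum bs_mult bs_var_less intro!: sum.cong)

lemma bs_tree_poly_eq_0: "t \<noteq> \<langle>\<rangle> \<Longrightarrow> bs a (tree_poly a t a) = 0"
  by (cases t) (simp_all add: bs_mult bs_var_eq)

lemma tree_poly_Suc_eq_0: "t \<noteq> \<langle>\<rangle> \<Longrightarrow> tree_poly a t (Suc a) = 0"
  by (cases t) simp_all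

text \<open>
  Leaves are counted from 0 at the leftmost one; the parent of the leaves \<open>d\<close> and \<open>d + 1\<close> is
  replaced by a leaf, if these two are siblings.
\<close>

fun trim_tree :: "nat \<Rightarrow> 'a tree \<Rightarrow> 'a tree option" where
  "trim_tree d \<langle>\<rangle> = None"
| "trim_tree d \<langle>l, v, r\<rangle> =
    (if d = 0 \<and> l = \<langle>\<rangle> then (if r = \<langle>\<rangle> then Some \<langle>\<rangle> else None)
     else if d \<le> size l then map_option (\<lambda>l'. \<langle>l', v, r\<rangle>) (trim_tree d l)
     else map_option (\<lambda>r'. \<langle>l, v, r'\<rangle>) (trim_tree (d - Suc (size l)) r))"

lemma size_trim_tree: "trim_tree d t = Some t' \<Longrightarrow> size t = Suc (size t')"
  by (induction t arbitrary: d t') (auto split: if_splits)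

text \<open>The difference of the two substitutions localises at leaf \<open>d\<close>. If this leaf
  lies in \<open>l\<close>, they act on the factor of \<open>r\<close> by moving its first leaf down
  by one; if it lies in \<open>r\<close>, the factor of \<open>l\<close> has only smaller colors and
  stays fixed.\<close>

lemma bs_Suc_tree_poly:
  "k \<le> a \<Longrightarrow> bs (Suc (a + d)) (tree_poly a t k) = bs (a + d) (tree_poly a t k) +
    qvar (a + d) * (case trim_tree d t of None \<Rightarrow> 0 | Some t' \<Rightarrow> tree_poly a t' k)"
proof (induction t arbitrary: a d k)
  case Leaf
  show ?case by simp
next
  case (Node l v r)
  define b where "b = Suc (a + size l)"
  define f where "f = (\<lambda>m. tree_poly a l m)"
  define g where "g = (\<lambda>m. tree_poly b r (Suc m))"
  define f' where "f' = (\<lambda>m. case trim_tree d l of None \<Rightarrow> 0 | Some t' \<Rightarrow> tree_poly a t' m)"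
  have poly: "tree_poly a \<langle>l, v, r\<rangle> k = (\<Sum>m = k..a. qvar m * (f m * g m))"
    by (simp add: f_def g_def b_def)
  have f: "bs (Suc (a + d)) (f m) = bs (a + d) (f m) + qvar (a + d) * f' m" if "m \<le> a" for m
    using Node.IH(1)[of m a d] that by (simp add: f_def f'_def)
  have var: "bs (Suc (a + d)) (qvar m) = qvar m" if "m \<le> a" for m
    using that by (intro bs_var_less) auto
  have var': "bs (a + d) (qvar m) = qvar m" if "m \<le> a" "m < a + d" for m
    using that by (intro bs_var_less) auto
  show ?case
  proof (cases "d \<le> size l")
    case True
    define h where "h = (\<lambda>m. tree_poly (a + size l) r (Suc m))"
    have g: "bs (Suc (a + d)) (g m) = h m" if "m \<le> a" for m
      unfolding g_def h_def b_def using that True by (intro bs_tree_poly_left) auto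
    have g': "bs (a + d) (g m) = h m" if "m \<le> a" "m < a + d" for m
      unfolding g_def h_def b_def using that True by (intro bs_tree_poly_left) auto
    show ?thesis
    proof (cases "d = 0 \<and> l = \<langle>\<rangle>")
      case d: True
      \<comment> \<open>Only the summand for color \<open>a\<close> differs: \<open>bs a\<close>
        kills it, and after \<open>bs (Suc a)\<close> it survives only if \<open>r\<close> is a
        leaf.\<close>
      have "{k..a} = insert a {k..<a}" using Node.prems by auto
      moreover have "h a = (if r = \<langle>\<rangle> then 1 else 0)"
        using d tree_poly_Suc_eq_0[of r a] by (auto simp: h_def)
      ultimately show ?thesis
        unfolding poly using d g g' var var' bs_var_eq[of a]
        by (simp add: bs_add bs_sum bs_mult f_def)
    next
      case not_d: False
      have step: "bs (Suc (a + d)) (qvar m * (f m * g m)) =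
          bs (a + d) (qvar m * (f m * g m)) + qvar (a + d) * (qvar m * (f' m * h m))"
        if m: "m \<le> a" for m
      proof (cases "m < a + d")
        case True
        thus ?thesis using m by (simp add: bs_mult f g g' var var' algebra_simps)
      next
        case False
        \<comment> \<open>In this boundary case \<open>l\<close> is nonempty and its root color is
          forced to be \<open>a\<close>, so \<open>bs a\<close> annihilates its factor.\<close>
        hence md: "d = 0" "m = a" using m by auto
        with not_d have "bs (a + d) (f m) = 0"
          by (simp add: f_def bs_tree_poly_eq_0)
        thus ?thesis using m md f[OF m] g[OF m] var[OF m] by (simp add: bs_mult)
      qed
      have "bs (Suc (a + d)) (tree_poly a \<langle>l, v, r\<rangle> k) = bs (a + d) (tree_poly a \<langle>l, v, r\<rangle> k) +
          qvar (a + d) * (\<Sum>m = k..a. qvar m * (f' m * h m))"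
        unfolding poly by (simp add: bs_sum step sum.distrib sum_distrib_left)
      \<comment> \<open>Trimming removes one node of \<open>l\<close>, so \<open>r\<close> now
        starts at \<open>a + size l\<close>, as in \<open>h\<close>.\<close>
      moreover have "(\<Sum>m = k..a. qvar m * (f' m * h m)) =
          (case trim_tree d \<langle>l, v, r\<rangle> of None \<Rightarrow> 0 | Some t' \<Rightarrow> tree_poly a t' k)"
        using True not_d by (auto simp: f'_def h_def split: option.split dest!: size_trim_tree)
      ultimately show ?thesis by simp
    qed
  next
    case False
    \<comment> \<open>Leaf \<open>d\<close> of the whole tree is leaf \<open>e\<close> of
      \<open>r\<close>, whose leftmost leaf has position \<open>b\<close>.\<close>
    define e where "e = d - Suc (size l)"
    have d: "a + d = b + e" and ab: "a < b" using False by (simp_all add: b_def e_def)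
    define g' where "g' = (\<lambda>m. case trim_tree e r of None \<Rightarrow> 0 | Some t' \<Rightarrow> tree_poly b t' (Suc m))"
    have g: "bs (Suc (a + d)) (g m) = bs (a + d) (g m) + qvar (a + d) * g' m" if "m \<le> a" for m
      unfolding d using Node.IH(2)[of "Suc m" b e] that ab by (simp add: g_def g'_def)
    have f: "bs i (f m) = f m" if "i \<ge> a + d" for m i
      unfolding f_def using False that by (intro bs_tree_poly_right) auto
    have "bs (Suc (a + d)) (qvar m * (f m * g m)) =
          bs (a + d) (qvar m * (f m * g m)) + qvar (a + d) * (qvar m * (f m * g' m))"
        if m: "m \<le> a" for m
      using m False by (simp add: bs_mult f g var var' algebra_simps)
    hence "bs (Suc (a + d)) (tree_poly a \<langle>l, v, r\<rangle> k) = bs (a + d) (tree_poly a \<langle>l, v, r\<rangle> k) +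
          qvar (a + d) * (\<Sum>m = k..a. qvar m * (f m * g' m))"
      unfolding poly by (simp add: bs_sum sum.distrib sum_distrib_left)
    moreover have "(\<Sum>m = k..a. qvar m * (f m * g' m)) =
        (case trim_tree d \<langle>l, v, r\<rangle> of None \<Rightarrow> 0 | Some t' \<Rightarrow> tree_poly a t' k)"
      using False by (auto simp: f_def g'_def b_def e_def split: option.split)
    ultimately show ?thesis by simp
  qed
qed

text \<open>
  A list of trees represents an indexed forest: a leaf as list entry stands for a trivial tree, so
  that the tree following \<open>t\<close> starts \<open>size t + 1\<close> leaves later, and the label in between is a gap of
  the support. Trailing trivial trees do not change the forest.
\<close>

fun trees_poly :: "nat \<Rightarrow> 'a tree list \<Rightarrow> qpoly" where
  "trees_poly a [] = 1"
| "trees_poly a (t # ts) = tree_poly a t 1 * trees_poly (Suc (a + size t)) ts"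

text \<open>Leaves are numbered through the whole list. For \<open>d = size t\<close> leaf
  \<open>d\<close> is the last one of \<open>t\<close>, has no sibling to its right, and
  \<open>trim_tree\<close> returns \<open>None\<close>.\<close>

fun trim :: "nat \<Rightarrow> 'a tree list \<Rightarrow> 'a tree list option" where
  "trim d [] = None"
| "trim d (t # ts) =
    (if d \<le> size t then map_option (\<lambda>t'. t' # ts) (trim_tree d t)
     else map_option ((#) t) (trim (d - Suc (size t)) ts))"

lemma bs_trees_poly: "0 < i \<Longrightarrow> i \<le> Suc a \<Longrightarrow> bs i (trees_poly (Suc a) ts) = trees_poly a ts"
  by (induction ts arbitrary: a) (simp_all add: bs_mult bs_tree_poly_left)

text \<open>Trees before the trimmed one have only smaller colors and stay fixed; later ones move
  down by one leaf, which accounts for the removed node.\<close>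

lemma bs_Suc_trees_poly:
  "0 < a \<Longrightarrow> bs (Suc (a + d)) (trees_poly a ts) = bs (a + d) (trees_poly a ts) +
    qvar (a + d) * (case trim d ts of None \<Rightarrow> 0 | Some ts' \<Rightarrow> trees_poly a ts')"
proof (induction ts arbitrary: a d)
  case (Cons t ts)
  show ?case
  proof (cases "d \<le> size t")
    case True
    thus ?thesis using Cons.prems bs_Suc_tree_poly[of 1 a d t]
      by (auto simp: bs_mult bs_trees_poly distrib_right mult.assoc split: option.split
          dest!: size_trim_tree)
  next
    case False
    hence "Suc (a + size t) + (d - Suc (size t)) = a + d" by simp
    thus ?thesis using False Cons.IH[of "Suc (a + size t)" "d - Suc (size t)"]
      by (auto simp: bs_mult bs_tree_poly_right distrib_left mult.left_commute split: option.split)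
  qed
qed simp

lemma qdd_trees_poly:
  "qdd (Suc d) (trees_poly 1 ts) = (case trim d ts of None \<Rightarrow> 0 | Some ts' \<Rightarrow> trees_poly 1 ts')"
  using bs_Suc_trees_poly[of 1 d ts] by (intro qdd_unique) simp

lemma ev0_tree_poly: "ev0 (tree_poly a t k) = (if t = \<langle>\<rangle> then 1 else 0)"
proof (cases t)
  case (Node l v r)
  have "ev0 (\<Sum>m\<in>A. qvar m * f m) = 0" for A f
    by (induction A rule: infinite_finite_induct) (simp_all add: ev0_add ev0_mult)
  thus ?thesis using Node by simp
qed simp

lemma ev0_trees_poly: "ev0 (trees_poly a ts) = (if set ts \<subseteq> {\<langle>\<rangle>} then 1 else 0)"
  by (induction ts arbitrary: a) (simp_all add: ev0_mult ev0_tree_poly)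

section \<open>Codes of forests\<close>

fun incr_hd :: "nat list \<Rightarrow> nat list" where
  "incr_hd [] = []"
| "incr_hd (x # xs) = Suc x # xs"

text \<open>
  Entry \<open>j\<close> is the number of nodes from which following left children ends in leaf \<open>j\<close>. Trimming is
  transparent on codes: it turns \<open>(\<dots>, c + 1, 0, \<dots>)\<close> into \<open>(\<dots>, c, \<dots>)\<close>.
\<close>

fun tree_code :: "'a tree \<Rightarrow> nat list" where
  "tree_code \<langle>\<rangle> = [0]"
| "tree_code \<langle>l, v, r\<rangle> = incr_hd (tree_code l) @ tree_code r"

definition code :: "'a tree list \<Rightarrow> nat list" where
  "code ts = concat (map tree_code ts)"

lemma code_simps [simp]: "code [] = []" "code (t # ts) = tree_code t @ code ts"
  by (simp_all add: code_def)

lemma code_append: "code (ts @ ts') = code ts @ code ts'"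
  by (simp add: code_def)

lemma code_replicate_Leaf: "code (replicate n \<langle>\<rangle>) = replicate n 0"
  by (induction n) simp_all

lemma length_incr_hd [simp]: "length (incr_hd xs) = length xs"
  by (cases xs) simp_all

lemma incr_hd_append: "xs \<noteq> [] \<Longrightarrow> incr_hd (xs @ ys) = incr_hd xs @ ys"
  by (cases xs) simp_all

lemma length_tree_code [simp]: "length (tree_code t) = Suc (size t)"
  by (induction t) simp_all

lemma tree_code_not_Nil [simp]: "tree_code t \<noteq> []"
  by (metis length_0_conv length_tree_code nat.simps(3))

lemma nth_incr_hd: "j < length xs \<Longrightarrow> incr_hd xs ! j = (if j = 0 then Suc (xs ! 0) else xs ! j)"
  by (cases xs) (auto simp: nth_Cons')

lemma tree_code_hd: "t \<noteq> \<langle>\<rangle> \<Longrightarrow> tree_code t ! 0 > 0"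
  by (cases t) (simp_all add: nth_append nth_incr_hd)

lemma tree_code_last: "tree_code t ! size t = 0"
  by (induction t) (simp_all add: nth_append)

text \<open>Extension by zeros identifies the codes of lists that differ only by trailing trivial
  trees, that is, of lists for the same forest.\<close>

definition pad :: "nat list \<Rightarrow> nat \<Rightarrow> nat" where
  "pad xs j = (if j < length xs then xs ! j else 0)"

lemma pad_Nil: "pad [] = (\<lambda>_. 0)"
  by (simp add: pad_def fun_eq_iff)

lemma pad_Cons: "pad (x # xs) = case_nat x (pad xs)"
  by (auto simp: pad_def fun_eq_iff split: nat.split)

lemma pad_append_zeros: "pad (xs @ replicate n 0) = pad xs"
  by (auto simp: pad_def fun_eq_iff nth_append)

lemma pad_eq_0_iff: "pad xs = (\<lambda>_. 0) \<longleftrightarrow> (\<forall>x\<in>set xs. x = 0)"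
  by (auto simp: pad_def fun_eq_iff all_set_conv_all_nth)

text \<open>The inverse of trimming on codes: a new node above leaf \<open>d\<close> raises its
  entry by one, and the new leaf to its right has entry 0.\<close>

definition insert_code :: "nat \<Rightarrow> (nat \<Rightarrow> nat) \<Rightarrow> nat \<Rightarrow> nat" where
  "insert_code d c j =
    (if j < d then c j else if j = d then Suc (c d) else if j = Suc d then 0 else c (j - 1))"

lemma inj_insert_code: "insert_code d c = insert_code d c' \<longleftrightarrow> c = c'"
proof
  assume eq: "insert_code d c = insert_code d c'"
  show "c = c'"
  proof
    fix j
    show "c j = c' j"
      using fun_cong[OF eq, of j] fun_cong[OF eq, of "Suc j"]
      by (auto simp: insert_code_def split: if_splits)
  qed
qed simp

lemma pad_insert_code: "pad (us @ Suc c # 0 # vs) = insert_code (length us) (pad (us @ c # vs))"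
  by (auto simp: pad_def insert_code_def fun_eq_iff nth_append nth_Cons')

lemma trim_tree_Some:
  "trim_tree d t = Some t' \<Longrightarrow> \<exists>us c vs. length us = d \<and>
    tree_code t = us @ Suc c # 0 # vs \<and> tree_code t' = us @ c # vs"
proof (induction t arbitrary: d t')
  case (Node l v r)
  consider "d = 0" "l = \<langle>\<rangle>" "r = \<langle>\<rangle>" "t' = \<langle>\<rangle>"
    | l' where "d \<le> size l" "trim_tree d l = Some l'" "t' = \<langle>l', v, r\<rangle>"
    | r' where "d > size l" "trim_tree (d - Suc (size l)) r = Some r'" "t' = \<langle>l, v, r'\<rangle>"
    using Node.prems by (auto split: if_splits)
  thus ?case
  proof cases
    case 1
    thus ?thesis by (intro exI[of _ "[]"] exI[of _ 0]) simp
  next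
    case 2
    from Node.IH(1)[OF 2(2)] obtain us c vs where
      IH: "length us = d" "tree_code l = us @ Suc c # 0 # vs" "tree_code l' = us @ c # vs" by blast
    show ?thesis
    proof (cases us)
      \<comment> \<open>The increment coming from the root falls on the trimmed entry itself, hence
        the witness \<open>Suc c\<close>.\<close>
      case Nil
      thus ?thesis using IH 2(3)
        by (intro exI[of _ "[]"] exI[of _ "Suc c"] exI[of _ "vs @ tree_code r"]) simp
    next
      case (Cons x xs)
      thus ?thesis using IH 2(3)
        by (intro exI[of _ "incr_hd us"] exI[of _ c] exI[of _ "vs @ tree_code r"]) simp
    qed
  next
    case 3
    from Node.IH(2)[OF 3(2)] obtain us c vs where
      "length us = d - Suc (size l)" "tree_code r = us @ Suc c # 0 # vs" "tree_code r' = us @ c # vs"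
      by blast
    thus ?thesis using 3
      by (intro exI[of _ "incr_hd (tree_code l) @ us"] exI[of _ c] exI[of _ vs]) simp
  qed
qed simp

text \<open>A leaf that is not a left child has entry 0. A leaf that is a left child with a
  nontrivial sibling is followed by the leftmost leaf of that sibling, whose entry is
  positive.\<close>

lemma trim_tree_None:
  "trim_tree d t = None \<Longrightarrow> d \<le> size t \<Longrightarrow>
    tree_code t ! d = 0 \<or> d < size t \<and> tree_code t ! Suc d > 0"
proof (induction t arbitrary: d)
  case (Node l v r)
  consider "d = 0" "l = \<langle>\<rangle>" "r \<noteq> \<langle>\<rangle>" | "d = 0" "l \<noteq> \<langle>\<rangle>" "trim_tree d l = None"
    | "0 < d" "d \<le> size l" "trim_tree d l = None"
    | "size l < d" "trim_tree (d - Suc (size l)) r = None"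
    using Node.prems by (cases "d = 0") (auto split: if_splits)
  thus ?case
  proof cases
    case 1
    thus ?thesis by (simp add: tree_code_hd)
  next
    case 2
    thus ?thesis using Node.IH(1)[of d] tree_code_hd[of l]
      by (auto simp: nth_append nth_incr_hd)
  next
    case 3
    thus ?thesis using Node.IH(1)[of d] by (auto simp: nth_append nth_incr_hd)
  next
    case 4
    then obtain e where "d = Suc (size l) + e"
      by (metis Suc_leI le_Suc_ex)
    thus ?thesis using 4 Node.IH(2)[of e] Node.prems
      by (auto simp: nth_append)
  qed
qed simp

lemma trim_Some:
  "trim d ts = Some ts' \<Longrightarrow> \<exists>us c vs. length us = d \<and>
    code ts = us @ Suc c # 0 # vs \<and> code ts' = us @ c # vs"
proof (induction ts arbitrary: d ts')
  case (Cons t ts)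
  show ?case
  proof (cases "d \<le> size t")
    case True
    with Cons.prems obtain t' where t': "trim_tree d t = Some t'" "ts' = t' # ts" by auto
    from trim_tree_Some[OF t'(1)] obtain us c vs where
      "length us = d" "tree_code t = us @ Suc c # 0 # vs" "tree_code t' = us @ c # vs" by blast
    thus ?thesis using t' by (intro exI[of _ us] exI[of _ c] exI[of _ "vs @ code ts"]) simp
  next
    case False
    with Cons.prems obtain ts'' where
      ts'': "trim (d - Suc (size t)) ts = Some ts''" "ts' = t # ts''" by auto
    from Cons.IH[OF ts''(1)] obtain us c vs where
      "length us = d - Suc (size t)" "code ts = us @ Suc c # 0 # vs" "code ts'' = us @ c # vs"
      by blast
    thus ?thesis using ts'' False
      by (intro exI[of _ "tree_code t @ us"] exI[of _ c] exI[of _ vs]) simp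
  qed
qed simp

lemma trim_None: "trim d ts = None \<Longrightarrow> pad (code ts) d = 0 \<or> pad (code ts) (Suc d) > 0"
proof (induction ts arbitrary: d)
  case (Cons t ts)
  show ?case
  proof (cases "d \<le> size t")
    case True
    with Cons.prems have "trim_tree d t = None" by simp
    from trim_tree_None[OF this True] True tree_code_last[of t] show ?thesis
      by (auto simp: pad_def nth_append)
  next
    case False
    then obtain e where "d = Suc (size t) + e"
      by (metis Suc_leI le_Suc_ex not_le)
    with Cons.prems Cons.IH[of e] show ?thesis
      by (auto simp: pad_def nth_append split: if_splits)
  qed
qed (simp add: pad_def)

text \<open>Starting from the empty forest, the trims of the word are undone, last letter first.
  Letters count from 1 and leaves from 0, hence \<open>i - 1\<close>.\<close>

fun word_code :: "nat list \<Rightarrow> nat \<Rightarrow> nat" where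
  "word_code [] = (\<lambda>_. 0)"
| "word_code (i # w) = insert_code (i - 1) (word_code w)"

lemma code_eq_0_iff: "pad (code ts) = (\<lambda>_. 0) \<longleftrightarrow> set ts \<subseteq> {\<langle>\<rangle>}"
proof (induction ts)
  case (Cons t ts)
  have "(\<forall>x\<in>set (tree_code t). x = 0) \<longleftrightarrow> t = \<langle>\<rangle>"
  proof (cases "t = \<langle>\<rangle>")
    case False
    have "tree_code t ! 0 \<in> set (tree_code t)" by (rule nth_mem) simp
    with tree_code_hd[OF False] False show ?thesis by (metis less_irrefl)
  qed simp
  with Cons show ?case by (simp add: pad_eq_0_iff ball_Un)
qed (simp add: pad_eq_0_iff)

text \<open>Each letter either annihilates the polynomial or trims the forest, and on codes trimming
  is inverse to \<open>insert_code\<close>. So exactly the forests with the code built by the word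
  give 1.\<close>

lemma qdd_coeff_trees_poly:
  "0 \<notin> set w \<Longrightarrow>
    qdd_coeff w (trees_poly 1 ts) = (if pad (code ts) = word_code w then 1 else 0)"
proof (induction w arbitrary: ts)
  case Nil
  show ?case by (simp add: ev0_trees_poly code_eq_0_iff del: One_nat_def)
next
  case (Cons i w)
  then obtain d where i: "i = Suc d" by (cases i) auto
  show ?case
  proof (cases "trim d ts")
    case None
    have "insert_code d c d \<noteq> 0" "insert_code d c (Suc d) = 0" for c
      by (simp_all add: insert_code_def)
    hence "pad (code ts) \<noteq> insert_code d (word_code w)"
      using trim_None[OF None] by (metis less_irrefl)
    thus ?thesis using None by (simp add: i qdd_trees_poly del: One_nat_def)
  next
    case (Some ts')
    then obtain us c vs where "length us = d" "code ts = us @ Suc c # 0 # vs" "code ts' = us @ c # vs"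
      using trim_Some by blast
    hence "pad (code ts) = insert_code d (pad (code ts'))"
      by (simp add: pad_insert_code)
    thus ?thesis using Some Cons.IH[of ts'] Cons.prems
      by (simp add: i qdd_trees_poly inj_insert_code del: One_nat_def)
  qed
qed

lemma qdd_positive_trees_poly: "qdd_positive (trees_poly 1 ts)"
  by (simp add: qdd_positive_def qdd_coeff_trees_poly del: One_nat_def)

text \<open>A letter at least as large as all later ones inserts where only zeros follow, so it
  merely raises one entry.\<close>

lemma word_code_decreasing:
  "0 \<notin> set w \<Longrightarrow> sorted_wrt (\<ge>) w \<Longrightarrow> word_code w j = count_list w (Suc j)"
proof (induction w arbitrary: j)
  case (Cons i w)
  then obtain d where i: "i = Suc d" by (cases i) auto
  have "count_list w j = 0" if "j > i" for j
    using Cons.prems(2) that by (auto simp: count_list_0_iff)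
  thus ?case using Cons by (auto simp: i insert_code_def)
qed simp

lemma word_code_decreasing_inj:
  assumes "0 \<notin> set w" "sorted_wrt (\<ge>) w" "0 \<notin> set w'" "sorted_wrt (\<ge>) w'"
    and "word_code w = word_code w'"
  shows "w = w'"
proof -
  have "count_list w j = count_list w' j" for j
    using fun_cong[OF assms(5), of "j - 1"] assms(1-4)
    by (cases j) (simp_all add: word_code_decreasing count_list_0_iff)
  hence "mset (rev w) = mset (rev w')"
    by (simp add: multiset_eq_iff count_mset)
  moreover have "sorted (rev w)" "sorted (rev w')"
    using assms(2,4) by (simp_all add: sorted_wrt_rev)
  ultimately have "rev w = rev w'"
    by (metis properties_for_sort)
  thus ?thesis by simp
qed

text \<open>Codes are built from left to right: raising the last entry is an insertion there, as the
  zero it adds is invisible to \<open>pad\<close>.\<close>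

lemma pad_eq_word_code: "\<exists>w. 0 \<notin> set w \<and> word_code w = pad xs"
proof (induction xs rule: rev_induct)
  case Nil
  show ?case by (intro exI[of _ "[]"]) (simp add: pad_Nil)
next
  case (snoc x xs)
  show ?case
  proof (induction x)
    case 0
    show ?case using snoc pad_append_zeros[of xs 1] by simp
  next
    case (Suc x)
    then obtain w where "0 \<notin> set w" "word_code w = pad (xs @ [x])" by blast
    moreover have "pad (xs @ [Suc x]) = insert_code (length xs) (pad (xs @ [x]))"
      using pad_insert_code[of xs x "[]"] pad_append_zeros[of "xs @ [Suc x]" 1] by simp
    ultimately show ?case by (intro exI[of _ "Suc (length xs) # w"]) simp
  qed
qed

lemma word_code_eq_pad: "\<exists>xs. word_code w = pad xs"
proof (induction w)
  case Nil
  show ?case by (intro exI[of _ "[]"]) (simp add: pad_Nil)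
next
  case (Cons i w)
  define d where "d = i - 1"
  from Cons obtain xs where xs: "word_code w = pad xs" by blast
  define ys where "ys = xs @ replicate (Suc d) 0"
  have d: "d < length ys" by (simp add: ys_def)
  have ys: "take d ys @ ys ! d # drop (Suc d) ys = ys"
    by (rule id_take_nth_drop[OF d, symmetric])
  have len: "length (take d ys) = d" using d by simp
  have "word_code (i # w) = insert_code d (pad ys)"
    by (simp add: xs d_def ys_def pad_append_zeros del: replicate.simps)
  also have "\<dots> = pad (take d ys @ Suc (ys ! d) # 0 # drop (Suc d) ys)"
    by (simp only: pad_insert_code ys len)
  finally show ?case by blast
qed

text \<open>Reading a code from the right, an entry \<open>c\<close> creates a leaf and joins it with the next \<open>c\<close> trees.\<close>

fun merge :: "unit tree list \<Rightarrow> unit tree list" where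
  "merge [] = []"
| "merge [t] = [\<langle>t, (), \<langle>\<rangle>\<rangle>]"
| "merge (t # u # ts) = \<langle>t, (), u\<rangle> # ts"

fun decode :: "nat list \<Rightarrow> unit tree list" where
  "decode [] = []"
| "decode (c # cs) = (merge ^^ c) (\<langle>\<rangle> # decode cs)"

lemma decode_incr_hd: "xs \<noteq> [] \<Longrightarrow> decode (incr_hd xs) = merge (decode xs)"
  by (cases xs) simp_all

text \<open>The root adds one to the head of the code, that is, one more \<open>merge\<close>, which
  joins the two decoded subtrees.\<close>

lemma decode_tree_code: "decode (tree_code t @ xs) = t # decode xs"
proof (induction t arbitrary: xs)
  case (Node l v r)
  have "decode (tree_code \<langle>l, v, r\<rangle> @ xs) = decode (incr_hd (tree_code l @ tree_code r @ xs))"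
    by (simp add: incr_hd_append)
  also have "\<dots> = merge (decode (tree_code l @ tree_code r @ xs))"
    by (rule decode_incr_hd) simp
  finally show ?case by (simp add: Node.IH)
qed simp

lemma decode_code: "decode (code ts) = ts"
  by (induction ts) (simp_all add: decode_tree_code)

text \<open>A lone tree is merged with an implicit trivial tree, whose entry 0 does not affect
  \<open>pad\<close>.\<close>

lemma pad_code_merge:
  "ts \<noteq> [] \<Longrightarrow> pad (code (merge ts)) = (pad (code ts))(0 := Suc (pad (code ts) 0))"
proof (induction ts rule: merge.induct)
  case (2 t)
  have "pad (incr_hd (tree_code t) @ [0]) = pad (incr_hd (tree_code t))"
    using pad_append_zeros[of "incr_hd (tree_code t)" 1] by simp
  thus ?case by (auto simp: pad_def fun_eq_iff nth_incr_hd)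
next
  case (3 t u ts)
  thus ?case by (auto simp: pad_def fun_eq_iff nth_incr_hd nth_append)
qed simp

lemma pad_code_merge_funpow:
  assumes "ts \<noteq> []"
  shows "(merge ^^ c) ts \<noteq> [] \<and>
    pad (code ((merge ^^ c) ts)) = (pad (code ts))(0 := c + pad (code ts) 0)"
proof (induction c)
  case (Suc c)
  have "merge ts \<noteq> []" if "ts \<noteq> []" for ts
    using that by (cases ts rule: merge.cases) simp_all
  thus ?case using Suc by (simp add: pad_code_merge fun_eq_iff)
qed (simp add: assms)

lemma pad_code_decode: "pad (code (decode xs)) = pad xs"
proof (induction xs)
  case (Cons x xs)
  show ?case
    using Cons pad_code_merge_funpow[of "\<langle>\<rangle> # decode xs" x]
    by (auto simp: pad_Cons fun_eq_iff split: nat.split)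
qed simp

lemma pad_code_eqD:
  fixes ts ts' :: "unit tree list"
  assumes "pad (code ts) = pad (code ts')"
  obtains m n where "ts @ replicate m \<langle>\<rangle> = ts' @ replicate n \<langle>\<rangle>"
proof -
  \<comment> \<open>Each code is extended by the length of the other, so both reach the same length
    before decoding.\<close>
  define m n where "m = length (code ts')" and "n = length (code ts)"
  have nth: "(xs @ replicate k 0) ! j = pad xs j" if "j < length xs + k" for xs :: "nat list" and k j
    using that by (simp add: pad_def nth_append)
  have "code ts @ replicate m 0 = code ts' @ replicate n 0"
    by (rule nth_equalityI) (simp_all add: nth m_def n_def assms)
  hence "code (ts @ replicate m \<langle>\<rangle>) = code (ts' @ replicate n \<langle>\<rangle>)"
    by (simp add: code_append code_replicate_Leaf)
  hence "ts @ replicate m \<langle>\<rangle> = ts' @ replicate n \<langle>\<rangle>"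
    by (metis decode_code)
  thus thesis by (rule that)
qed

section \<open>Indexed forests and their colorings\<close>

text \<open>Canonical labels: the node between the leaves at positions \<open>j\<close> and
  \<open>j + 1\<close> gets label \<open>j\<close>, so the labels start at the leftmost leaf
  \<open>a\<close>.\<close>

fun labelled :: "nat \<Rightarrow> 'a tree \<Rightarrow> int tree" where
  "labelled a \<langle>\<rangle> = \<langle>\<rangle>"
| "labelled a \<langle>l, v, r\<rangle> =
    \<langle>labelled a l, int (a + size l), labelled (Suc (a + size l)) r\<rangle>"

lemma labelled_eq_Leaf [simp]: "labelled a t = \<langle>\<rangle> \<longleftrightarrow> t = \<langle>\<rangle>"
  by (cases t) simp_all

lemma upt_split_mid: "[a..<a + (m + Suc n)] = [a..<a + m] @ (a + m) # [Suc (a + m)..<Suc (a + m) + n]"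
proof -
  have "[a..<a + (m + Suc n)] = [a..<a + m] @ [a + m..<a + m + Suc n]"
    unfolding add.assoc[symmetric] by (rule upt_add_eq_append) simp
  thus ?thesis by (simp only: upt_conv_Cons[of "a + m" "a + m + Suc n"]) simp
qed

lemma inorder_labelled: "inorder (labelled a t) = map int [a..<a + size t]"
proof (induction t arbitrary: a)
  case (Node l v r)
  show ?case
    using upt_split_mid[of a "size l" "size r"] by (simp add: Node.IH add.assoc del: upt_Suc)
qed simp

lemma set_tree_labelled: "set_tree (labelled a t) = {int a..<int (a + size t)}"
  by (simp flip: set_inorder add: inorder_labelled image_int_atLeastLessThan)

lemma leftmost_label_labelled: "t \<noteq> \<langle>\<rangle> \<Longrightarrow> leftmost_label (labelled a t) = int a"
proof (induction t)
  case (Node l v r)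
  thus ?case by (cases l) simp_all
qed simp

lemma labelled_map_tree:
  "inorder t = map int [a..<a + size t] \<Longrightarrow> labelled a (map_tree f t) = t"
proof (induction t arbitrary: a)
  case (Node l v r)
  have "[a..<a + size \<langle>l, v, r\<rangle>] =
      [a..<a + size l] @ (a + size l) # [Suc (a + size l)..<Suc (a + size l) + size r]"
    using upt_split_mid[of a "size l" "size r"] by (simp add: add.assoc del: upt_Suc)
  with Node.prems have "inorder l = map int [a..<a + size l]" "v = int (a + size l)"
    "inorder r = map int [Suc (a + size l)..<Suc (a + size l) + size r]"
    by (simp_all del: upt_Suc)
  thus ?case by (simp add: Node.IH del: upt_Suc)
qed simp

section \<open>Correspondence of indexed forests and lists of trees\<close>

lemma support_simps [simp]: "support [] = {}" "support (T # F) = set_tree T \<union> support F"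
  by (simp_all add: support_def)

text \<open>Maximality of the block filled by \<open>T\<close> makes \<open>y + 1\<close> a gap.
  This recursive form permits induction along the list.\<close>

lemma indexed_forest_Cons_iff:
  "indexed_forest (T # F) \<longleftrightarrow> (\<exists>x y. x \<le> y \<and> set_tree T = {x..y} \<and>
    inorder T = sorted_list_of_set {x..y} \<and> indexed_forest F \<and> support F \<subseteq> {y + 2..})"
  (is "?L \<longleftrightarrow> ?R")
proof
  assume L: ?L
  then obtain x y where xy: "x \<le> y" "set_tree T = {x..y}" "y + 1 \<notin> support (T # F)"
    by (auto simp: indexed_forest_def consecutive_blocks_def)
  have less: "\<forall>T'\<in>set F. \<forall>i\<in>set_tree T. \<forall>j\<in>set_tree T'. i < j"
    using L by (auto simp: indexed_forest_def)
  have supp: "support F \<subseteq> {y + 2..}"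
  proof
    fix j assume j: "j \<in> support F"
    hence "y < j" using less xy(1,2) by (auto simp: support_def)
    moreover have "j \<noteq> y + 1" using j xy(3) by auto
    ultimately show "j \<in> {y + 2..}" by simp
  qed
  have "set_tree T' \<in> consecutive_blocks (support F)" if T': "T' \<in> set F" for T'
  proof -
    have "set_tree T' \<in> consecutive_blocks (support (T # F))"
      using L T' by (auto simp: indexed_forest_def)
    moreover have "set_tree T' \<subseteq> support F" using T' by (auto simp: support_def)
    ultimately show ?thesis unfolding consecutive_blocks_def by auto
  qed
  hence "indexed_forest F" using L by (auto simp: indexed_forest_def)
  thus ?R using xy supp L by (auto simp: indexed_forest_def)
next
  assume ?R
  then obtain x y where xy: "x \<le> y" "set_tree T = {x..y}"
    "inorder T = sorted_list_of_set {x..y}" and F: "indexed_forest F" "support F \<subseteq> {y + 2..}"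
    by blast
  have "set_tree T' \<in> consecutive_blocks (support (T # F))" if T': "T' \<in> set F" for T'
  proof -
    obtain a b where ab: "a \<le> b" "set_tree T' = {a..b}" "{a..b} \<subseteq> support F"
      "a - 1 \<notin> support F" "b + 1 \<notin> support F"
      using F(1) T' by (auto simp: indexed_forest_def consecutive_blocks_def)
    moreover have "a \<ge> y + 2" using ab(1,3) F(2) by auto
    ultimately show ?thesis unfolding consecutive_blocks_def
      by (intro CollectI exI[of _ a] exI[of _ b]) (auto simp: xy(2))
  qed
  moreover have "set_tree T \<in> consecutive_blocks (support (T # F))"
    unfolding consecutive_blocks_def using xy F(2)
    by (intro CollectI exI[of _ x] exI[of _ y]) auto
  moreover have "\<forall>T'\<in>set F. \<forall>i\<in>set_tree T. \<forall>j\<in>set_tree T'. i < j"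
    using F(2) xy(2) by (force simp: support_def)
  ultimately show ?L using xy F(1) by (auto simp: indexed_forest_def)
qed

fun forest_of :: "nat \<Rightarrow> 'a tree list \<Rightarrow> forest" where
  "forest_of a [] = []"
| "forest_of a (t # ts) =
    (if t = \<langle>\<rangle> then [] else [labelled a t]) @ forest_of (Suc (a + size t)) ts"

lemma support_forest_of: "support (forest_of a ts) \<subseteq> {int a..}"
proof (induction ts arbitrary: a)
  case (Cons t ts)
  have "support (forest_of (Suc (a + size t)) ts) \<subseteq> {int a..}"
    using Cons[of "Suc (a + size t)"] by (rule order_trans) simp
  thus ?case by (auto simp: set_tree_labelled)
qed simp

lemma indexed_forest_forest_of: "indexed_forest (forest_of a ts)"
proof (induction ts arbitrary: a)
  case Nil
  show ?case by (simp add: indexed_forest_def)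
next
  case (Cons t ts)
  show ?case
  proof (cases "t = \<langle>\<rangle>")
    case False
    hence "size t > 0" by (cases t) simp_all
    moreover from this have set: "set_tree (labelled a t) = {int a..int (a + size t) - 1}"
      by (auto simp: set_tree_labelled)
    moreover have "inorder (labelled a t) = sorted_list_of_set (set_tree (labelled a t))"
      unfolding set_inorder[symmetric]
      by (rule sorted_list_of_set.idem_if_sorted_distinct[symmetric])
        (simp_all add: inorder_labelled sorted_map distinct_map)
    moreover have "support (forest_of (Suc (a + size t)) ts) \<subseteq> {int (a + size t) - 1 + 2..}"
      using support_forest_of[of "Suc (a + size t)" ts] by auto
    ultimately show ?thesis using False Cons.IH[of "Suc (a + size t)"]
      by (auto simp: indexed_forest_Cons_iff intro!: exI[of _ "int a"] exI[of _ "int (a + size t) - 1"])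
  qed (use Cons in simp)
qed

lemma forest_of_in_IndFor_plus: "forest_of 1 ts \<in> IndFor_plus"
  using support_forest_of[of 1 ts] by (simp add: IndFor_plus_def indexed_forest_forest_of)

lemma forest_of_append:
  "forest_of a (ts @ ts') = forest_of a ts @ forest_of (a + sum_list (map (Suc \<circ> size) ts)) ts'"
  by (induction ts arbitrary: a) (simp_all add: add.assoc)

lemma forest_of_replicate_Leaf [simp]: "forest_of a (replicate n \<langle>\<rangle>) = []"
  by (induction n arbitrary: a) simp_all

lemma forest_of_surj:
  "indexed_forest F \<Longrightarrow> support F \<subseteq> {int a..} \<Longrightarrow> \<exists>ts :: unit tree list. forest_of a ts = F"
proof (induction F arbitrary: a)
  case Nil
  show ?case by (intro exI[of _ "[]"]) simp
next
  case (Cons T F)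
  from Cons.prems(1) obtain x y where xy: "x \<le> y" "set_tree T = {x..y}"
    "inorder T = sorted_list_of_set {x..y}" and F: "indexed_forest F" "support F \<subseteq> {y + 2..}"
    by (auto simp: indexed_forest_Cons_iff)
  have ax: "int a \<le> x" using xy(1,2) Cons.prems(2) by auto
  define b where "b = nat x"
  have b: "x = int b" "a \<le> b" using ax by (auto simp: b_def)
  have "length (inorder T) = nat (y - x + 1)" by (simp add: xy(3))
  hence size: "y = int (b + size T) - 1" using xy(1) b by simp
  have "sorted_list_of_set (set (map int [b..<b + size T])) = map int [b..<b + size T]"
    by (rule sorted_list_of_set.idem_if_sorted_distinct) (simp_all add: sorted_map distinct_map)
  moreover have "set (map int [b..<b + size T]) = {x..y}"
    by (auto simp: image_int_atLeastLessThan b size)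
  ultimately have "inorder T = map int [b..<b + size T]" using xy(3) by simp
  hence T: "labelled b (map_tree (\<lambda>_. ()) T) = T" by (rule labelled_map_tree)
  have "support F \<subseteq> {int (Suc (b + size T))..}" using F(2) by (auto simp: size)
  from Cons.IH[OF F(1) this] obtain ts :: "unit tree list"
    where ts: "forest_of (Suc (b + size T)) ts = F" by blast
  have "T \<noteq> \<langle>\<rangle>" using xy(1,2) by auto
  moreover have "a + sum_list (map (Suc \<circ> size) (replicate (b - a) (\<langle>\<rangle> :: unit tree))) = b"
    using b(2) by (simp add: sum_list_replicate)
  \<comment> \<open>The \<open>b - a\<close> trivial trees in front advance the first leaf from
    \<open>a\<close> to \<open>b\<close>, where \<open>T\<close> begins.\<close>
  ultimately have
    "forest_of a (replicate (b - a) \<langle>\<rangle> @ map_tree (\<lambda>_. ()) T # ts) = T # F"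
    by (simp add: forest_of_append T ts del: map_replicate)
  thus ?case by blast
qed

lemma IndFor_plus_forest_of: "F \<in> IndFor_plus \<Longrightarrow> \<exists>ts :: unit tree list. forest_of 1 ts = F"
  using forest_of_surj[of F 1] by (simp add: IndFor_plus_def)

lemma forest_of_eqI:
  fixes ts ts' :: "unit tree list"
  assumes "pad (code ts) = pad (code ts')"
  shows "forest_of a ts = forest_of a ts'"
proof -
  from pad_code_eqD[OF assms] obtain m n where
    "ts @ replicate m \<langle>\<rangle> = ts' @ replicate n \<langle>\<rangle>" by blast
  hence "forest_of a (ts @ replicate m \<langle>\<rangle>) = forest_of a (ts' @ replicate n \<langle>\<rangle>)" by simp
  thus ?thesis by (simp add: forest_of_append)
qed

section \<open>Colorings by recursion on the tree\<close>

fun root_ge :: "nat \<Rightarrow> ('a \<Rightarrow> nat) \<Rightarrow> 'a tree \<Rightarrow> bool" where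
  "root_ge k \<kappa> \<langle>\<rangle> \<longleftrightarrow> True"
| "root_ge k \<kappa> \<langle>l, v, r\<rangle> \<longleftrightarrow> k \<le> \<kappa> v"

fun node_valid :: "(int \<Rightarrow> nat) \<Rightarrow> int tree \<Rightarrow> bool" where
  "node_valid \<kappa> \<langle>\<rangle> \<longleftrightarrow> True"
| "node_valid \<kappa> \<langle>l, v, r\<rangle> \<longleftrightarrow> int (\<kappa> v) \<le> leftmost_label \<langle>l, v, r\<rangle> \<and>
    root_ge (\<kappa> v) \<kappa> l \<and> root_ge (Suc (\<kappa> v)) \<kappa> r"

lemma node_valid_subtrees_iff:
  "(\<forall>s\<in>subtrees T. node_valid \<kappa> s) \<longleftrightarrow>
     (\<forall>l v r. \<langle>l, v, r\<rangle> \<in> subtrees T \<longrightarrow> int (\<kappa> v) \<le> leftmost_label \<langle>l, v, r\<rangle>) \<and>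
     (\<forall>l w l' u r. \<langle>\<langle>l, w, l'\<rangle>, u, r\<rangle> \<in> subtrees T \<longrightarrow> \<kappa> w \<ge> \<kappa> u) \<and>
     (\<forall>l u r w r'. \<langle>l, u, \<langle>r, w, r'\<rangle>\<rangle> \<in> subtrees T \<longrightarrow> \<kappa> w > \<kappa> u)"
  (is "?L \<longleftrightarrow> ?R1 \<and> ?R2 \<and> ?R3")
proof (intro iffI conjI allI impI ballI)
  fix l v r assume ?L "\<langle>l, v, r\<rangle> \<in> subtrees T"
  thus "int (\<kappa> v) \<le> leftmost_label \<langle>l, v, r\<rangle>" by (metis node_valid.simps(2))
next
  fix l w l' u r assume ?L "\<langle>\<langle>l, w, l'\<rangle>, u, r\<rangle> \<in> subtrees T"
  thus "\<kappa> w \<ge> \<kappa> u" by (metis node_valid.simps(2) root_ge.simps(2))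
next
  fix l u r w r' assume ?L "\<langle>l, u, \<langle>r, w, r'\<rangle>\<rangle> \<in> subtrees T"
  thus "\<kappa> w > \<kappa> u" by (metis node_valid.simps(2) root_ge.simps(2) Suc_le_eq)
next
  fix s assume R: "?R1 \<and> ?R2 \<and> ?R3" and s: "s \<in> subtrees T"
  show "node_valid \<kappa> s"
  proof (cases s)
    case (Node l v r)
    have "root_ge (\<kappa> v) \<kappa> l"
    proof (cases l)
      case l: (Node l1 w l2)
      have "\<kappa> v \<le> \<kappa> w" using R s unfolding Node l by blast
      thus ?thesis by (simp add: l)
    qed simp
    moreover have "root_ge (Suc (\<kappa> v)) \<kappa> r"
    proof (cases r)
      case r: (Node r1 w r2)
      have "\<kappa> v < \<kappa> w" using R s unfolding Node r by blast
      thus ?thesis by (simp add: r)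
    qed simp
    moreover have "int (\<kappa> v) \<le> leftmost_label \<langle>l, v, r\<rangle>" using R s unfolding Node by blast
    ultimately show ?thesis by (simp only: Node node_valid.simps)
  qed simp
qed

fun valid :: "int tree \<Rightarrow> nat \<Rightarrow> (int \<Rightarrow> nat) \<Rightarrow> bool" where
  "valid \<langle>\<rangle> k \<kappa> \<longleftrightarrow> True"
| "valid \<langle>l, v, r\<rangle> k \<kappa> \<longleftrightarrow> k \<le> \<kappa> v \<and> int (\<kappa> v) \<le> leftmost_label \<langle>l, v, r\<rangle> \<and>
    valid l (\<kappa> v) \<kappa> \<and> valid r (Suc (\<kappa> v)) \<kappa>"

lemma valid_iff: "valid T k \<kappa> \<longleftrightarrow> root_ge k \<kappa> T \<and> (\<forall>s\<in>subtrees T. node_valid \<kappa> s)"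
  by (induction T arbitrary: k) auto

lemma valid_ge: "valid T k \<kappa> \<Longrightarrow> v \<in> set_tree T \<Longrightarrow> k \<le> \<kappa> v"
proof (induction T arbitrary: k)
  case (Node l u r)
  consider "v = u" | "v \<in> set_tree l" | "v \<in> set_tree r" using Node.prems(2) by auto
  thus ?case
    using Node.prems(1) Node.IH(1)[of "\<kappa> u"] Node.IH(2)[of "Suc (\<kappa> u)"] by cases auto
qed simp

lemma valid_mono: "valid T k \<kappa> \<Longrightarrow> k' \<le> k \<Longrightarrow> valid T k' \<kappa>"
  by (cases T) auto

lemma valid_cong:
  "(\<And>v. v \<in> set_tree T \<Longrightarrow> \<kappa> v = \<kappa>' v) \<Longrightarrow> valid T k \<kappa> = valid T k \<kappa>'"
  by (induction T arbitrary: k) auto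

text \<open>Positivity of all colors follows from positivity at the roots, since colors never
  decrease from parent to child.\<close>

lemma colorings_eq:
  "colorings F = {\<kappa>. \<kappa> \<in> extensional (support F) \<and> (\<forall>T\<in>set F. valid T 1 \<kappa>)}"
proof -
  have "root_ge 1 \<kappa> T" if "\<kappa> \<in> support F \<rightarrow>\<^sub>E {1..}" "T \<in> set F" for \<kappa> T
  proof (cases T)
    case (Node l v r)
    hence "v \<in> support F" using that(2) unfolding support_def by (intro UN_I[of T]) simp_all
    thus ?thesis using that(1) Node by auto
  qed simp
  moreover have "\<kappa> \<in> support F \<rightarrow>\<^sub>E {1..}"
    if "\<kappa> \<in> extensional (support F)" "\<forall>T\<in>set F. valid T 1 \<kappa>" for \<kappa>
  proof -
    have "1 \<le> \<kappa> v" if "v \<in> support F" for v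
      using that \<open>\<forall>T\<in>set F. valid T 1 \<kappa>\<close> valid_ge[of _ 1 \<kappa> v] by (auto simp: support_def)
    thus ?thesis using that(1) by (simp add: PiE_iff)
  qed
  moreover have "\<kappa> \<in> extensional (support F)" if "\<kappa> \<in> support F \<rightarrow>\<^sub>E {1..}" for \<kappa>
    using that by (auto simp: PiE_iff)
  ultimately show ?thesis
    unfolding colorings_def node_valid_subtrees_iff[symmetric] valid_iff by blast
qed

text \<open>A function on a disjoint union is a pair of functions, and each condition sees only one
  of them, so the sum factors.\<close>

lemma sum_extensional_Un:
  fixes g :: "'b \<Rightarrow> 'c :: comm_semiring_1"
  assumes "A \<inter> B = {}" "finite A" "finite B"
    and P: "\<And>\<kappa> \<kappa>'. (\<And>v. v \<in> A \<Longrightarrow> \<kappa> v = \<kappa>' v) \<Longrightarrow> P \<kappa> = P \<kappa>'"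
    and Q: "\<And>\<kappa> \<kappa>'. (\<And>v. v \<in> B \<Longrightarrow> \<kappa> v = \<kappa>' v) \<Longrightarrow> Q \<kappa> = Q \<kappa>'"
  shows "(\<Sum>\<kappa> | \<kappa> \<in> extensional (A \<union> B) \<and> P \<kappa> \<and> Q \<kappa>. \<Prod>v\<in>A \<union> B. g (\<kappa> v)) =
    (\<Sum>\<kappa> | \<kappa> \<in> extensional A \<and> P \<kappa>. \<Prod>v\<in>A. g (\<kappa> v)) *
    (\<Sum>\<kappa> | \<kappa> \<in> extensional B \<and> Q \<kappa>. \<Prod>v\<in>B. g (\<kappa> v))"
proof -
  define glue where "glue = (\<lambda>(\<kappa>, \<kappa>'). restrict (\<lambda>v. if v \<in> A then \<kappa> v else \<kappa>' v :: 'b) (A \<union> B))"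
  have P_glue: "P (glue (\<kappa>, \<kappa>')) = P \<kappa>" for \<kappa> \<kappa>'
    by (rule P) (simp add: glue_def)
  have Q_glue: "Q (glue (\<kappa>, \<kappa>')) = Q \<kappa>'" for \<kappa> \<kappa>'
    by (rule Q) (use assms(1) in \<open>auto simp: glue_def\<close>)
  have P_res: "P (restrict \<kappa> A) = P \<kappa>" for \<kappa> by (rule P) simp
  have Q_res: "Q (restrict \<kappa> B) = Q \<kappa>" for \<kappa> by (rule Q) simp
  show ?thesis
    unfolding sum_product sum.cartesian_product
  proof (rule sum.reindex_bij_witness[of _ glue "\<lambda>\<kappa>. (restrict \<kappa> A, restrict \<kappa> B)"])
    fix \<kappa> assume "\<kappa> \<in> {\<kappa>. \<kappa> \<in> extensional (A \<union> B) \<and> P \<kappa> \<and> Q \<kappa>}"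
    thus "glue (restrict \<kappa> A, restrict \<kappa> B) = \<kappa>"
      by (auto simp: glue_def fun_eq_iff extensional_def)
  next
    fix p assume "p \<in> {\<kappa>. \<kappa> \<in> extensional A \<and> P \<kappa>} \<times> {\<kappa>. \<kappa> \<in> extensional B \<and> Q \<kappa>}"
    thus "(restrict (glue p) A, restrict (glue p) B) = p"
      using assms(1) by (auto simp: glue_def fun_eq_iff extensional_def)
  next
    fix p assume "p \<in> {\<kappa>. \<kappa> \<in> extensional A \<and> P \<kappa>} \<times> {\<kappa>. \<kappa> \<in> extensional B \<and> Q \<kappa>}"
    thus "glue p \<in> {\<kappa>. \<kappa> \<in> extensional (A \<union> B) \<and> P \<kappa> \<and> Q \<kappa>}"
      using P_glue Q_glue by (auto simp: glue_def)
  qed (use assms(1-3) in \<open>simp_all add: P_res Q_res prod.union_disjoint\<close>)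
qed

text \<open>Colorings are grouped by the root color \<open>m\<close>, which is at most the leftmost
  label \<open>a\<close>. For fixed \<open>m\<close> the conditions on the two subtrees are
  independent, with lower bounds \<open>m\<close> and \<open>Suc m\<close>.\<close>

lemma sum_valid_labelled:
  "k > 0 \<Longrightarrow>
    (\<Sum>\<kappa> | \<kappa> \<in> extensional (set_tree (labelled a t)) \<and> valid (labelled a t) k \<kappa>.
      \<Prod>v\<in>set_tree (labelled a t). qvar (\<kappa> v)) = tree_poly a t k"
proof (induction t arbitrary: a k)
  case Leaf
  show ?case by (simp add: extensional_empty)
next
  case (Node l u r)
  define L R v where "L = labelled a l" and "R = labelled (Suc (a + size l)) r"
    and "v = int (a + size l)"
  define S where "S = {v} \<union> (set_tree L \<union> set_tree R)"
  have T: "labelled a \<langle>l, u, r\<rangle> = \<langle>L, v, R\<rangle>" "set_tree \<langle>L, v, R\<rangle> = S"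
    by (auto simp: L_def R_def v_def S_def)
  have left: "leftmost_label \<langle>L, v, R\<rangle> = int a"
    using leftmost_label_labelled[of "\<langle>l, u, r\<rangle>" a] by (simp only: T) simp
  have disj: "{v} \<inter> (set_tree L \<union> set_tree R) = {}" "set_tree L \<inter> set_tree R = {}"
    by (auto simp: L_def R_def v_def set_tree_labelled)
  define K where "K = {\<kappa>. \<kappa> \<in> extensional S \<and> valid \<langle>L, v, R\<rangle> k \<kappa>}"
  \<comment> \<open>This gives finiteness of \<open>K\<close>; \<open>k > 0\<close> makes the colors
    positive.\<close>
  have "K \<subseteq> colorings [\<langle>L, v, R\<rangle>]"
    unfolding colorings_eq K_def using Node.prems T(2)
    by (auto simp del: valid.simps simp: valid_mono[of _ k _ "Suc 0"])
  hence fin: "finite K" using finite_colorings finite_subset by blast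
  have im: "(\<lambda>\<kappa>. \<kappa> v) ` K \<subseteq> {k..a}" by (auto simp: K_def left)
  have inner: "(\<Sum>\<kappa> | \<kappa> \<in> K \<and> \<kappa> v = m. \<Prod>x\<in>S. qvar (\<kappa> x)) =
      qvar m * (tree_poly a l m * tree_poly (Suc (a + size l)) r (Suc m))"
    if m: "m \<in> {k..a}" for m
  proof -
    have "{\<kappa>. \<kappa> \<in> K \<and> \<kappa> v = m} =
        {\<kappa>. \<kappa> \<in> extensional S \<and> \<kappa> v = m \<and> valid L m \<kappa> \<and> valid R (Suc m) \<kappa>}"
      using m left by (auto simp: K_def)
    hence "(\<Sum>\<kappa> | \<kappa> \<in> K \<and> \<kappa> v = m. \<Prod>x\<in>S. qvar (\<kappa> x)) =
        (\<Sum>\<kappa> | \<kappa> \<in> extensional ({v} \<union> (set_tree L \<union> set_tree R)) \<and> \<kappa> v = m \<and>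
            (valid L m \<kappa> \<and> valid R (Suc m) \<kappa>).
          \<Prod>x\<in>{v} \<union> (set_tree L \<union> set_tree R). qvar (\<kappa> x))"
      unfolding S_def by (rule sum.cong[OF _ refl])
    also have "\<dots> =
        (\<Sum>\<kappa> | \<kappa> \<in> extensional {v} \<and> \<kappa> v = m. \<Prod>x\<in>{v}. qvar (\<kappa> x)) *
        (\<Sum>\<kappa> | \<kappa> \<in> extensional (set_tree L \<union> set_tree R) \<and> valid L m \<kappa> \<and> valid R (Suc m) \<kappa>.
          \<Prod>x\<in>set_tree L \<union> set_tree R. qvar (\<kappa> x))"
    proof (rule sum_extensional_Un[OF disj(1)])
      fix \<kappa> \<kappa>' :: "int \<Rightarrow> nat" assume "\<And>x. x \<in> set_tree L \<union> set_tree R \<Longrightarrow> \<kappa> x = \<kappa>' x"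
      thus "(valid L m \<kappa> \<and> valid R (Suc m) \<kappa>) = (valid L m \<kappa>' \<and> valid R (Suc m) \<kappa>')"
        using valid_cong[of L \<kappa> \<kappa>' m] valid_cong[of R \<kappa> \<kappa>' "Suc m"] by blast
    qed simp_all
    also have "(\<Sum>\<kappa> | \<kappa> \<in> extensional {v} \<and> \<kappa> v = m. \<Prod>x\<in>{v}. qvar (\<kappa> x)) = qvar m"
    proof -
      have "{\<kappa>. \<kappa> \<in> extensional {v} \<and> \<kappa> v = m} = {restrict (\<lambda>_. m) {v}}"
        by (auto simp: extensional_def fun_eq_iff)
      thus ?thesis by simp
    qed
    also have "(\<Sum>\<kappa> | \<kappa> \<in> extensional (set_tree L \<union> set_tree R) \<and> valid L m \<kappa> \<and> valid R (Suc m) \<kappa>.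
          \<Prod>x\<in>set_tree L \<union> set_tree R. qvar (\<kappa> x)) =
        (\<Sum>\<kappa> | \<kappa> \<in> extensional (set_tree L) \<and> valid L m \<kappa>. \<Prod>x\<in>set_tree L. qvar (\<kappa> x)) *
        (\<Sum>\<kappa> | \<kappa> \<in> extensional (set_tree R) \<and> valid R (Suc m) \<kappa>. \<Prod>x\<in>set_tree R. qvar (\<kappa> x))"
      by (rule sum_extensional_Un[OF disj(2)]) (simp, simp, (rule valid_cong, assumption)+)
    also have "\<dots> = tree_poly a l m * tree_poly (Suc (a + size l)) r (Suc m)"
      using m Node.prems Node.IH(1)[of m a] Node.IH(2)[of "Suc m" "Suc (a + size l)"]
      by (simp add: L_def R_def)
    finally show ?thesis .
  qed
  have "(\<Sum>\<kappa>\<in>K. \<Prod>x\<in>S. qvar (\<kappa> x)) =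
      (\<Sum>m = k..a. \<Sum>\<kappa> | \<kappa> \<in> K \<and> \<kappa> v = m. \<Prod>x\<in>S. qvar (\<kappa> x))"
    by (rule sum.group[OF fin _ im, symmetric]) simp
  also have "\<dots> = tree_poly a \<langle>l, u, r\<rangle> k" by (simp add: inner)
  finally show ?case unfolding T K_def .
qed

lemma forest_poly_forest_of: "forest_poly (forest_of a ts) = trees_poly a ts"
proof (induction ts arbitrary: a)
  case Nil
  show ?case by (simp add: forest_poly_Nil)
next
  case (Cons t ts)
  define T F where "T = labelled a t" and "F = forest_of (Suc (a + size t)) ts"
  show ?case
  proof (cases "t = \<langle>\<rangle>")
    case False
    have disj: "set_tree T \<inter> support F = {}"
      using support_forest_of[of "Suc (a + size t)" ts]
      by (auto simp: T_def F_def set_tree_labelled)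
    have "forest_poly (T # F) =
        (\<Sum>\<kappa> | \<kappa> \<in> extensional (set_tree T \<union> support F) \<and> valid T 1 \<kappa> \<and> (\<forall>T'\<in>set F. valid T' 1 \<kappa>).
          \<Prod>v\<in>set_tree T \<union> support F. qvar (\<kappa> v))"
      by (simp add: forest_poly_def colorings_eq)
    also have "\<dots> = (\<Sum>\<kappa> | \<kappa> \<in> extensional (set_tree T) \<and> valid T 1 \<kappa>. \<Prod>v\<in>set_tree T. qvar (\<kappa> v)) *
        (\<Sum>\<kappa> | \<kappa> \<in> extensional (support F) \<and> (\<forall>T'\<in>set F. valid T' 1 \<kappa>). \<Prod>v\<in>support F. qvar (\<kappa> v))"
    proof (rule sum_extensional_Un)
      fix \<kappa> \<kappa>' :: "int \<Rightarrow> nat" assume "\<And>v. v \<in> set_tree T \<Longrightarrow> \<kappa> v = \<kappa>' v"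
      thus "valid T 1 \<kappa> = valid T 1 \<kappa>'" by (rule valid_cong)
    next
      fix \<kappa> \<kappa>' :: "int \<Rightarrow> nat" assume "\<And>v. v \<in> support F \<Longrightarrow> \<kappa> v = \<kappa>' v"
      hence "valid T' 1 \<kappa> = valid T' 1 \<kappa>'" if "T' \<in> set F" for T'
        by (intro valid_cong) (use that in \<open>auto simp: support_def\<close>)
      thus "(\<forall>T'\<in>set F. valid T' 1 \<kappa>) = (\<forall>T'\<in>set F. valid T' 1 \<kappa>')" by simp
    qed (simp_all add: disj finite_support)
    also have "\<dots> = tree_poly a t 1 * forest_poly F"
      unfolding T_def by (subst sum_valid_labelled) (simp_all add: forest_poly_def colorings_eq)
    finally show ?thesis using False Cons.IH by (simp add: T_def F_def)
  qed (use Cons in simp)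
qed

section \<open>Expansions in forest polynomials\<close>

definition mdeg :: "monom \<Rightarrow> nat" where
  "mdeg m = (\<Sum>j\<in>Poly_Mapping.keys m. Poly_Mapping.lookup m j)"

definition shift :: "nat \<Rightarrow> nat \<Rightarrow> nat" where
  "shift i j = (if j < i then j else Suc j)"

lemma inj_shift: "inj (shift i)"
  by (auto simp: inj_def shift_def split: if_splits)

lemma lookup_insert_zero_shift:
  "Poly_Mapping.lookup (insert_zero i m) (shift i j) = Poly_Mapping.lookup m j"
  by (simp add: insert_zero.rep_eq shift_def)

lemma keys_insert_zero: "Poly_Mapping.keys (insert_zero i m) = shift i ` Poly_Mapping.keys m"
proof (intro equalityI subsetI)
  fix j assume j: "j \<in> Poly_Mapping.keys (insert_zero i m)"
  define j' where "j' = (if j < i then j else j - 1)"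
  have "j = shift i j'"
    using j by (auto simp: in_keys_iff insert_zero.rep_eq shift_def j'_def split: if_splits)
  moreover from this have "j' \<in> Poly_Mapping.keys m"
    using j by (simp add: in_keys_iff lookup_insert_zero_shift)
  ultimately show "j \<in> shift i ` Poly_Mapping.keys m" by blast
next
  fix j assume "j \<in> shift i ` Poly_Mapping.keys m"
  thus "j \<in> Poly_Mapping.keys (insert_zero i m)"
    by (auto simp: in_keys_iff lookup_insert_zero_shift)
qed

lemma mdeg_insert_zero: "mdeg (insert_zero i m) = mdeg m"
  unfolding mdeg_def keys_insert_zero
  by (subst sum.reindex)
    (simp_all add: inj_on_subset[OF inj_shift] lookup_insert_zero_shift)

lemma mdeg_superset:
  "finite A \<Longrightarrow> Poly_Mapping.keys m \<subseteq> A \<Longrightarrow> mdeg m = (\<Sum>j\<in>A. Poly_Mapping.lookup m j)"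
  unfolding mdeg_def by (rule sum.mono_neutral_left) (auto simp: in_keys_iff)

lemma mdeg_add_single: "mdeg (m + Poly_Mapping.single i 1) = Suc (mdeg m)"
proof -
  define A where "A = insert i (Poly_Mapping.keys m)"
  have A: "finite A" "i \<in> A" by (simp_all add: A_def)
  have "mdeg (m + Poly_Mapping.single i 1) =
      (\<Sum>j\<in>A. Poly_Mapping.lookup m j + (if i = j then 1 else 0))"
    by (subst mdeg_superset[of A])
      (auto simp: A_def in_keys_iff lookup_add lookup_single when_def split: if_splits
        intro!: sum.cong)
  also have "\<dots> = mdeg m + 1"
    using A by (subst mdeg_superset[of A]) (auto simp: A_def sum.distrib)
  finally show ?thesis by simp
qed

definition vars_in :: "nat set \<Rightarrow> qpoly \<Rightarrow> bool" where
  "vars_in A f \<longleftrightarrow> (\<forall>m\<in>Poly_Mapping.keys f. Poly_Mapping.keys m \<subseteq> A)"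

lemma vars_in_0 [simp]: "vars_in A 0"
  by (simp add: vars_in_def)

lemma vars_in_1 [simp]: "vars_in A 1"
  by (simp add: vars_in_def)

lemma vars_in_const [simp]: "vars_in A (qconst c)"
  by (simp add: vars_in_def qconst_def)

lemma vars_in_qvar: "i \<in> A \<Longrightarrow> vars_in A (qvar i)"
  by (simp add: vars_in_def qvar_def)

lemma vars_in_add: "vars_in A f \<Longrightarrow> vars_in A g \<Longrightarrow> vars_in A (f + g)"
  using keys_add[of f g] by (auto simp: vars_in_def)

lemma vars_in_diff:
  assumes "vars_in A f" "vars_in A g"
  shows "vars_in A (f - g)"
  unfolding vars_in_def
proof
  fix m assume "m \<in> Poly_Mapping.keys (f - g)"
  hence "m \<in> Poly_Mapping.keys f \<or> m \<in> Poly_Mapping.keys g"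
    by (auto simp: in_keys_iff lookup_minus)
  thus "Poly_Mapping.keys m \<subseteq> A" using assms by (auto simp: vars_in_def)
qed

lemma vars_in_mult:
  assumes "vars_in A f" "vars_in A g"
  shows "vars_in A (f * g)"
  unfolding vars_in_def
proof
  fix m assume "m \<in> Poly_Mapping.keys (f * g)"
  then obtain a b where "m = a + b" "a \<in> Poly_Mapping.keys f" "b \<in> Poly_Mapping.keys g"
    using keys_mult[of f g] by auto
  thus "Poly_Mapping.keys m \<subseteq> A"
    using assms keys_add[of a b] unfolding vars_in_def by blast
qed

lemma vars_in_sum: "(\<And>x. x \<in> X \<Longrightarrow> vars_in A (f x)) \<Longrightarrow> vars_in A (\<Sum>x\<in>X. f x)"
  by (induction X rule: infinite_finite_induct) (simp_all add: vars_in_add)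

lemma vars_in_prod: "(\<And>x. x \<in> X \<Longrightarrow> vars_in A (f x)) \<Longrightarrow> vars_in A (\<Prod>x\<in>X. f x)"
  by (induction X rule: infinite_finite_induct) (simp_all add: vars_in_mult)

lemma vars_in_forest_poly: "vars_in {1..} (forest_poly F)"
proof -
  have "\<kappa> v \<in> {1..}" if "\<kappa> \<in> colorings F" "v \<in> support F" for \<kappa> v
    using that by (auto simp: colorings_def PiE_iff)
  thus ?thesis unfolding forest_poly_def by (intro vars_in_sum vars_in_prod vars_in_qvar)
qed

lemma vars_in_finite:
  assumes "vars_in {1..} f"
  obtains n where "vars_in {1..n} f"
proof -
  have "finite (\<Union>m\<in>Poly_Mapping.keys f. Poly_Mapping.keys m)" by simp
  then obtain n where "\<forall>j\<in>(\<Union>m\<in>Poly_Mapping.keys f. Poly_Mapping.keys m). j \<le> n"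
    using finite_nat_set_iff_bounded_le by blast
  hence "vars_in {1..n} f" using assms by (fastforce simp: vars_in_def)
  thus thesis by (rule that)
qed

definition deg_le :: "nat \<Rightarrow> qpoly \<Rightarrow> bool" where
  "deg_le D f \<longleftrightarrow> (\<forall>m\<in>Poly_Mapping.keys f. mdeg m \<le> D)"

lemma deg_le_ex: obtains D where "deg_le D f"
proof -
  have "finite (mdeg ` Poly_Mapping.keys f)" by simp
  then obtain D where "\<forall>d\<in>mdeg ` Poly_Mapping.keys f. d \<le> D"
    using finite_nat_set_iff_bounded_le by blast
  thus thesis by (intro that[of D]) (simp add: deg_le_def)
qed

text \<open>Controls degree and variables: a monomial of \<open>qdd i f\<close> comes from one of
  \<open>f\<close> by closing a gap and removing one factor x_i.\<close>

lemma keys_qddE: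
  assumes "m \<in> Poly_Mapping.keys (qdd i f)"
  obtains i' where "i' \<in> {i, Suc i}"
    "insert_zero i' (m + Poly_Mapping.single i 1) \<in> Poly_Mapping.keys f"
proof -
  let ?m = "m + Poly_Mapping.single i 1"
  have "Poly_Mapping.lookup f (insert_zero (Suc i) ?m) \<noteq> Poly_Mapping.lookup f (insert_zero i ?m)"
    using assms by (simp add: in_keys_iff lookup_qdd)
  hence "insert_zero (Suc i) ?m \<in> Poly_Mapping.keys f \<or> insert_zero i ?m \<in> Poly_Mapping.keys f"
    by (auto simp: in_keys_iff)
  thus thesis using that by blast
qed

lemma vars_in_qdd:
  assumes "vars_in {1..n} f" "i > 0"
  shows "vars_in {1..n} (qdd i f)"
  unfolding vars_in_def
proof (intro ballI subsetI)
  fix m j assume m: "m \<in> Poly_Mapping.keys (qdd i f)" and j: "j \<in> Poly_Mapping.keys m"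
  from keys_qddE[OF m] obtain i' where i': "i' \<in> {i, Suc i}"
    and key: "insert_zero i' (m + Poly_Mapping.single i 1) \<in> Poly_Mapping.keys f" by blast
  have "j \<in> Poly_Mapping.keys (m + Poly_Mapping.single i 1)"
    using j by (simp add: in_keys_iff lookup_add)
  \<comment> \<open>As \<open>i' > 0\<close>, \<open>shift i'\<close> fixes 0 and never lowers an
    index, so both bounds pass back to \<open>j\<close>.\<close>
  hence "shift i' j \<in> {1..n}"
    using key assms(1) unfolding vars_in_def by (metis imageI keys_insert_zero subsetD)
  thus "j \<in> {1..n}" using i' assms(2) by (auto simp: shift_def split: if_splits)
qed

lemma mdeg_qdd:
  assumes "deg_le D f" "m \<in> Poly_Mapping.keys (qdd i f)"
  shows "mdeg m < D"
proof -
  from keys_qddE[OF assms(2)] obtain i' where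
    "insert_zero i' (m + Poly_Mapping.single i 1) \<in> Poly_Mapping.keys f" by blast
  hence "mdeg (insert_zero i' (m + Poly_Mapping.single i 1)) \<le> D"
    using assms(1) by (simp add: deg_le_def)
  thus ?thesis unfolding mdeg_insert_zero mdeg_add_single by simp
qed

lemma qdd_deg_le_0: "deg_le 0 f \<Longrightarrow> qdd i f = 0"
  using mdeg_qdd[of 0 f _ i] by (metis keys_eq_empty ex_in_conv not_less_zero)

lemma deg_le_qdd: "deg_le (Suc D) f \<Longrightarrow> deg_le D (qdd i f)"
  using mdeg_qdd[of "Suc D" f _ i] unfolding less_Suc_eq_le deg_le_def[of D] by blast

lemma qdd_coeff_long: "deg_le D f \<Longrightarrow> length w > D \<Longrightarrow> qdd_coeff w f = 0"
proof (induction w arbitrary: D f)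
  case (Cons i w)
  show ?case
  proof (cases D)
    case 0
    thus ?thesis using Cons.prems by (simp add: qdd_deg_le_0)
  next
    case (Suc D')
    thus ?thesis using Cons.IH[of D' "qdd i f"] Cons.prems by (simp add: deg_le_qdd)
  qed
qed simp

text \<open>Without x_(n+2) the map \<open>bs (Suc (Suc n))\<close> fixes \<open>f\<close>, so
  \<open>bs (Suc n) f = f\<close>. On the left x_(n+1) could come only from x_(n+2), so it is
  absent.\<close>

lemma vars_in_shrink:
  assumes "vars_in {1..Suc n} f" "qdd (Suc n) f = 0"
  shows "vars_in {1..n} f"
  unfolding vars_in_def
proof
  fix m assume m: "m \<in> Poly_Mapping.keys f"
  have sub: "Poly_Mapping.keys m \<subseteq> {1..Suc n}" using assms(1) m by (simp add: vars_in_def)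
  have "Suc n \<notin> Poly_Mapping.keys m"
  proof
    assume n: "Suc n \<in> Poly_Mapping.keys m"
    have "Poly_Mapping.lookup m j = 0" if "j > Suc n" for j
      using sub that by (auto simp: in_keys_iff subset_iff)
    hence "insert_zero (Suc (Suc n)) m = m"
      by (intro poly_mapping_eqI) (auto simp: insert_zero.rep_eq)
    moreover have "bs (Suc (Suc n)) f = bs (Suc n) f"
      using bs_Suc[of "Suc n" f] assms(2) by simp
    ultimately have "Poly_Mapping.lookup f m = Poly_Mapping.lookup f (insert_zero (Suc n) m)"
      by (metis lookup_bs)
    hence "insert_zero (Suc n) m \<in> Poly_Mapping.keys f" using m by (simp add: in_keys_iff)
    moreover have "shift (Suc n) (Suc n) \<in> Poly_Mapping.keys (insert_zero (Suc n) m)"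
      using n unfolding keys_insert_zero by (rule imageI)
    ultimately have "shift (Suc n) (Suc n) \<in> {1..Suc n}"
      using assms(1) unfolding vars_in_def by blast
    thus False by (simp add: shift_def)
  qed
  thus "Poly_Mapping.keys m \<subseteq> {1..n}" using sub by (auto simp: le_Suc_eq)
qed

lemma vars_in_shrink_to:
  assumes "vars_in {1..} f" "\<And>i. i > n \<Longrightarrow> qdd i f = 0"
  shows "vars_in {1..n} f"
proof -
  from vars_in_finite[OF assms(1)] obtain N where "vars_in {1..N} f" .
  thus ?thesis
  proof (induction N)
    case 0
    thus ?case by (auto simp: vars_in_def)
  next
    case (Suc N)
    show ?case
    proof (cases "Suc N \<le> n")
      case True
      hence "{1..Suc N} \<subseteq> {1..n}" by auto
      thus ?thesis using Suc.prems unfolding vars_in_def by blast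
    next
      case False
      thus ?thesis using Suc vars_in_shrink assms(2) by simp
    qed
  qed
qed

definition decreasing_words :: "nat \<Rightarrow> nat list set" where
  "decreasing_words n = {w. set w \<subseteq> {1..n} \<and> sorted_wrt (\<ge>) w}"

text \<open>
  The largest letter suffices: for \<open>f\<close> in \<open>x\<^sub>1, \<dots>, x\<^sub>n\<close>, \<open>T\<^sub>n f = 0\<close> means that \<open>x\<^sub>n\<close> does not occur
  in \<open>f\<close>. This avoids showing that \<open>T\<^sub>w\<close> depends only on the forest of the word \<open>w\<close>.
\<close>

lemma qdd_coeff_determine:
  assumes "vars_in {1..n} f" "\<And>w. w \<in> decreasing_words n \<Longrightarrow> qdd_coeff w f = 0"
  shows "f = 0"
proof -
  obtain D where "deg_le D f" by (rule deg_le_ex)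
  thus ?thesis using assms
  proof (induction D arbitrary: n f rule: less_induct)
    case (less D)
    from less.prems show ?case
    proof (induction n)
      case 0
      have "Poly_Mapping.lookup f m = 0" for m
      proof (cases "m = 0")
        case True
        thus ?thesis using "0.prems"(3)[of "[]"] by (simp add: decreasing_words_def ev0_def)
      next
        case False
        thus ?thesis using "0.prems"(2) by (auto simp: vars_in_def in_keys_iff)
      qed
      thus ?case by (intro poly_mapping_eqI) simp
    next
      case (Suc n)
      have "qdd (Suc n) f = 0"
      proof (cases D)
        case 0
        thus ?thesis using Suc.prems(1) by (simp add: qdd_deg_le_0)
      next
        case D: (Suc D')
        \<comment> \<open>The quotient has smaller degree and the same variables; its coefficients
          are those of \<open>f\<close> along words with \<open>Suc n\<close> prepended.\<close>
        show ?thesis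
        proof (rule less.IH[of D' _ "Suc n"])
          fix w assume "w \<in> decreasing_words (Suc n)"
          hence "Suc n # w \<in> decreasing_words (Suc n)" by (auto simp: decreasing_words_def)
          from Suc.prems(3)[OF this] show "qdd_coeff w (qdd (Suc n) f) = 0" by simp
        next
          show "vars_in {1..Suc n} (qdd (Suc n) f)" using Suc.prems(2) by (rule vars_in_qdd) simp
        qed (use Suc.prems(1) D in \<open>simp_all add: deg_le_qdd\<close>)
      qed
      hence "vars_in {1..n} f" using Suc.prems(2) by (rule vars_in_shrink[rotated])
      moreover have "decreasing_words n \<subseteq> decreasing_words (Suc n)"
        by (auto simp: decreasing_words_def subset_iff)
      ultimately show ?case using Suc by blast
    qed
  qed
qed

section \<open>Dual functionals, uniqueness and existence of expansions\<close>

lemma vars_in_trees_poly_1: "vars_in {1..} (trees_poly 1 ts)"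
  by (metis forest_poly_forest_of vars_in_forest_poly)

text \<open>A trim at leaf \<open>d\<close> needs a positive entry there, so every
  \<open>qdd i\<close> with \<open>i > n\<close> annihilates the polynomial.\<close>

lemma vars_in_trees_poly:
  assumes "\<And>j. j \<ge> n \<Longrightarrow> pad (code ts) j = 0"
  shows "vars_in {1..n} (trees_poly 1 ts)"
proof (rule vars_in_shrink_to[OF vars_in_trees_poly_1])
  fix i assume "i > n"
  then obtain d where d: "i = Suc d" "d \<ge> n" by (cases i) auto
  show "qdd i (trees_poly 1 ts) = 0"
  proof (cases "trim d ts")
    case None
    thus ?thesis using d by (simp add: qdd_trees_poly del: One_nat_def)
  next
    case (Some ts')
    then obtain us c vs where "length us = d" "code ts = us @ Suc c # 0 # vs"
      using trim_Some by blast
    hence "pad (code ts) d = Suc c" by (simp add: pad_def nth_append)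
    thus ?thesis using assms d by simp
  qed
qed

text \<open>Any word whose code is that of \<open>G\<close> serves as coordinate functional, because
  the code determines the forest.\<close>

lemma forest_poly_dual:
  assumes "G \<in> IndFor_plus"
  obtains w where "0 \<notin> set w"
    "\<And>G'. G' \<in> IndFor_plus \<Longrightarrow> qdd_coeff w (forest_poly G') = (if G' = G then 1 else 0)"
proof -
  from IndFor_plus_forest_of[OF assms] obtain ts :: "unit tree list" where ts: "forest_of 1 ts = G" ..
  from pad_eq_word_code obtain w where w: "0 \<notin> set w" "word_code w = pad (code ts)" by blast
  have coeff: "qdd_coeff w (forest_poly (forest_of 1 ts')) = (if pad (code ts') = pad (code ts) then 1 else 0)"
    for ts' :: "unit tree list"
    using w by (simp add: forest_poly_forest_of qdd_coeff_trees_poly del: One_nat_def)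
  have "qdd_coeff w (forest_poly G') = (if G' = G then 1 else 0)" if "G' \<in> IndFor_plus" for G'
  proof (cases "G' = G")
    case True
    thus ?thesis using coeff[of ts] ts by simp
  next
    case False
    from IndFor_plus_forest_of[OF that] obtain ts' :: "unit tree list"
      where ts': "forest_of 1 ts' = G'" ..
    hence "pad (code ts') \<noteq> pad (code ts)" using False ts forest_of_eqI by blast
    thus ?thesis using coeff[of ts'] ts' False by simp
  qed
  thus thesis using w(1) by (rule that[rotated])
qed

text \<open>The word depends on \<open>G\<close> alone, which yields uniqueness and reduces
  integrality of coefficients to positivity.\<close>

lemma forest_expansion_coeff:
  assumes "G \<in> IndFor_plus"
  obtains w where "0 \<notin> set w"
    "\<And>p b. forest_expansion p b \<Longrightarrow> Poly_Mapping.lookup b G = qdd_coeff w p"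
proof -
  from forest_poly_dual[OF assms] obtain w where w: "0 \<notin> set w"
    "\<And>G'. G' \<in> IndFor_plus \<Longrightarrow> qdd_coeff w (forest_poly G') = (if G' = G then 1 else 0)" by blast
  have "Poly_Mapping.lookup b G = qdd_coeff w p" if "forest_expansion p b" for p b
  proof -
    have "qdd_coeff w p = (\<Sum>G'\<in>Poly_Mapping.keys b.
        Poly_Mapping.lookup b G' * qdd_coeff w (forest_poly G'))"
      using that by (simp add: forest_expansion_def qdd_coeff_sum qdd_coeff_const_mult)
    also have "\<dots> = (\<Sum>G'\<in>Poly_Mapping.keys b. if G' = G then Poly_Mapping.lookup b G' else 0)"
      using that w(2) by (intro sum.cong) (auto simp: forest_expansion_def)
    also have "\<dots> = Poly_Mapping.lookup b G"
      by (simp add: in_keys_iff)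
    finally show ?thesis by simp
  qed
  thus thesis using w(1) by (rule that[rotated])
qed

lemma forest_expansion_unique:
  assumes "forest_expansion p b" "forest_expansion p b'"
  shows "b = b'"
proof (rule poly_mapping_eqI)
  fix G
  show "Poly_Mapping.lookup b G = Poly_Mapping.lookup b' G"
  proof (cases "G \<in> IndFor_plus")
    case True
    from forest_expansion_coeff[OF this] assms show ?thesis by metis
  next
    case False
    hence "G \<notin> Poly_Mapping.keys b" "G \<notin> Poly_Mapping.keys b'"
      using assms by (auto simp: forest_expansion_def)
    thus ?thesis by (simp add: in_keys_iff)
  qed
qed

lemma forest_expansion_superset:
  assumes "finite A" "Poly_Mapping.keys b \<subseteq> A"
  shows "(\<Sum>G\<in>Poly_Mapping.keys b. qconst (Poly_Mapping.lookup b G) * forest_poly G) =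
    (\<Sum>G\<in>A. qconst (Poly_Mapping.lookup b G) * forest_poly G)"
  using assms by (intro sum.mono_neutral_left) (auto simp: in_keys_iff qconst_def)

lemma forest_expansion_add:
  assumes "forest_expansion p b" "forest_expansion q c"
  shows "forest_expansion (p + q) (b + c)"
proof -
  define A where "A = Poly_Mapping.keys b \<union> Poly_Mapping.keys c"
  have A: "finite A" "Poly_Mapping.keys b \<subseteq> A" "Poly_Mapping.keys c \<subseteq> A"
    "Poly_Mapping.keys (b + c) \<subseteq> A"
    using keys_add[of b c] by (auto simp: A_def)
  have "p = (\<Sum>G\<in>A. qconst (Poly_Mapping.lookup b G) * forest_poly G)"
    using assms(1) forest_expansion_superset[OF A(1,2)] by (simp add: forest_expansion_def)
  moreover have "q = (\<Sum>G\<in>A. qconst (Poly_Mapping.lookup c G) * forest_poly G)"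
    using assms(2) forest_expansion_superset[OF A(1,3)] by (simp add: forest_expansion_def)
  ultimately have "p + q = (\<Sum>G\<in>A. qconst (Poly_Mapping.lookup (b + c) G) * forest_poly G)"
    by (simp add: lookup_add qconst_def single_add distrib_right sum.distrib)
  also have "\<dots> =
      (\<Sum>G\<in>Poly_Mapping.keys (b + c). qconst (Poly_Mapping.lookup (b + c) G) * forest_poly G)"
    by (rule forest_expansion_superset[OF A(1,4), symmetric])
  finally have "p + q =
      (\<Sum>G\<in>Poly_Mapping.keys (b + c). qconst (Poly_Mapping.lookup (b + c) G) * forest_poly G)" .
  moreover have "A \<subseteq> IndFor_plus" using assms by (simp add: A_def forest_expansion_def)
  ultimately show ?thesis using A(4) unfolding forest_expansion_def by blast
qed

lemma forest_expansion_single: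
  "G \<in> IndFor_plus \<Longrightarrow> forest_expansion (qconst c * forest_poly G) (Poly_Mapping.single G c)"
  by (simp add: forest_expansion_def qconst_def)

lemma forest_expansion_sum:
  assumes "finite X" "\<And>x. x \<in> X \<Longrightarrow> forest_expansion (p x) (b x)"
  shows "forest_expansion (\<Sum>x\<in>X. p x) (\<Sum>x\<in>X. b x)"
  using assms
proof (induction X rule: finite_induct)
  case empty
  show ?case by (simp add: forest_expansion_def)
qed (simp add: forest_expansion_add)

text \<open>The candidate \<open>q\<close> has one term per decreasing word; it has the same
  coefficients as \<open>p\<close> along all these words, and these determine a polynomial.\<close>

lemma forest_expansion_exists:
  assumes "vars_in {1..} p"
  shows "\<exists>b. forest_expansion p b"
proof -
  from vars_in_finite[OF assms] obtain n where n: "vars_in {1..n} p" .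
  obtain D where D: "deg_le D p" by (rule deg_le_ex)
  \<comment> \<open>The length bound makes the sum finite; longer words have coefficient 0 by the
    degree of \<open>p\<close>.\<close>
  define W where "W = {w \<in> decreasing_words n. length w \<le> D}"
  have "W \<subseteq> {w. set w \<subseteq> {1..n} \<and> length w \<le> D}" by (auto simp: W_def decreasing_words_def)
  hence fin: "finite W" by (rule finite_subset) (simp add: finite_lists_length_le)
  have "\<exists>ts :: unit tree list. pad (code ts) = word_code w" for w
    by (metis word_code_eq_pad pad_code_decode)
  then obtain ts :: "nat list \<Rightarrow> unit tree list" where ts: "\<And>w. pad (code (ts w)) = word_code w"
    by metis
  have nz: "0 \<notin> set w" if "w \<in> decreasing_words n" for w
    using that by (auto simp: decreasing_words_def)
  define q where "q = (\<Sum>w\<in>W. qconst (qdd_coeff w p) * trees_poly 1 (ts w))"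
  have "p - q = 0"
  proof (rule qdd_coeff_determine)
    have "vars_in {1..n} (trees_poly 1 (ts w))" if "w \<in> W" for w
    proof (rule vars_in_trees_poly)
      fix j assume "j \<ge> n"
      moreover have "w \<in> decreasing_words n" using that by (simp add: W_def)
      ultimately show "pad (code (ts w)) j = 0"
        using nz[of w] by (auto simp: ts word_code_decreasing decreasing_words_def count_list_0_iff)
    qed
    thus "vars_in {1..n} (p - q)"
      unfolding q_def by (intro vars_in_diff n vars_in_sum vars_in_mult vars_in_const)
  next
    fix w assume w: "w \<in> decreasing_words n"
    have inj: "word_code w' = word_code w \<longleftrightarrow> w' = w" if "w' \<in> W" for w'
      using word_code_decreasing_inj[of w' w] that w nz
      by (auto simp: W_def decreasing_words_def)
    have "qdd_coeff w q = (\<Sum>w'\<in>W. if w' = w then qdd_coeff w' p else 0)"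
      unfolding q_def qdd_coeff_sum
      by (rule sum.cong)
        (simp_all add: qdd_coeff_const_mult qdd_coeff_trees_poly nz[OF w] ts inj del: One_nat_def)
    also have "\<dots> = (if w \<in> W then qdd_coeff w p else 0)" using fin by simp
    also have "\<dots> = qdd_coeff w p"
      using w qdd_coeff_long[OF D, of w] by (auto simp: W_def)
    finally show "qdd_coeff w (p - q) = 0" by (simp add: qdd_coeff_diff)
  qed
  moreover have "forest_expansion q (\<Sum>w\<in>W. Poly_Mapping.single (forest_of 1 (ts w)) (qdd_coeff w p))"
    unfolding q_def forest_poly_forest_of[symmetric]
    by (intro forest_expansion_sum fin forest_expansion_single forest_of_in_IndFor_plus)
  ultimately show ?thesis by auto
qed

lemma qdd_positive_forest_poly:
  assumes "indexed_forest F"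
  shows "qdd_positive (forest_poly F)"
proof (cases "F \<in> IndFor_plus")
  case True
  from IndFor_plus_forest_of[OF this] obtain ts :: "unit tree list" where "forest_of 1 ts = F" ..
  thus ?thesis using qdd_positive_trees_poly[of ts] by (metis forest_poly_forest_of)
next
  case False
  thus ?thesis using forest_poly_eq_0[OF assms] by (simp add: qdd_positive_def)
qed

theorem theorem6p3:
  fixes F1 F2 :: forest
  assumes "indexed_forest F1" and "indexed_forest F2"
  shows "(\<exists>!b. forest_expansion (forest_poly F1 * forest_poly F2) b) \<and>
    (\<forall>b. forest_expansion (forest_poly F1 * forest_poly F2) b \<longrightarrow>
      (\<forall>G. Poly_Mapping.lookup b G \<in> \<nat>))"
proof (intro conjI ex_ex1I allI impI)
  show "\<exists>b. forest_expansion (forest_poly F1 * forest_poly F2) b"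
    by (intro forest_expansion_exists vars_in_mult vars_in_forest_poly)
next
  fix b b'
  assume "forest_expansion (forest_poly F1 * forest_poly F2) b"
    "forest_expansion (forest_poly F1 * forest_poly F2) b'"
  thus "b = b'" by (rule forest_expansion_unique)
next
  fix b G
  assume b: "forest_expansion (forest_poly F1 * forest_poly F2) b"
  show "Poly_Mapping.lookup b G \<in> \<nat>"
  proof (cases "G \<in> IndFor_plus")
    case True
    from forest_expansion_coeff[OF this] b obtain w
      where "0 \<notin> set w" "Poly_Mapping.lookup b G = qdd_coeff w (forest_poly F1 * forest_poly F2)"
      by metis
    moreover have "qdd_positive (forest_poly F1 * forest_poly F2)"
      using assms by (intro qdd_positive_mult qdd_positive_forest_poly)
    ultimately show ?thesis by (simp add: qdd_positive_coeff)
  next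
    case False
    hence "G \<notin> Poly_Mapping.keys b" using b by (auto simp: forest_expansion_def)
    thus ?thesis by (simp add: in_keys_iff)
  qed
qed

end
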